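(* Fix $a,b,c\in\mathbb{R}$. The function $\mathbb{V}(m)=1+am+bm^2+cm^3$ is in $\mathcal{V}$ if and only if $(b+1)^3\ge 27c^2$. Furthermore, $\mathbb{V}$ is in $\mathcal{V}_\infty$ if and only if $b^3\ge 27c^2$.
   Context: Let $\nu$ be a non-degenerate compactly supported probability measure on $\mathbb{R}$ with $\int x\,\nu(dx)=0$. The variance function $\mathbb{V}_\nu$ of the Cauchy-Stieltjes Kernel (CSK) family generated by $\nu$ is the unique function $\mathbb{V}$, real analytic in a neighbourhood of $0$ with $\mathbb{V}(0)\neq 0$, such that for all $m$ in some open interval $(m_-,m_+)$ containing $0$ the formula $$Q_m(dx)=f(x,m)\,\nu(dx),\qquad f(x,m)=\frac{\mathbb{V}(m)}{\mathbb{V}(m)+m(m-x)}\ (m\ne 0),\quad f(x,0)=1,$$ defines a probability measure. (Existence and uniqueness are known; one then has $\int x\,Q_m(dx)=m$ and $\mathbb{V}(m)=\int (x-m)^2 Q_m(dx)$, so $\mathbb{V}_\nu(0)=\int x^2\nu(dx)$.) Variance functions are regarded as germs at $0$: two functions that agree near $0$ are identified. $\mathcal{V}$ denotes the class of variance functions $\mathbb{V}_\nu$ where $\nu$ is a compactly supported probability measure on $\mathbb{R}$ with $\int x\,\nu(dx)=0$ and $\int x^2\nu(dx)=1$ (so $\mathbb{V}_\nu(0)=1$). $\mathcal{V}_\infty$ denotes the class of those $\mathbb{V}\in\mathcal{V}$ such that the function $m\mapsto \mathbb{V}(cm)$ is in $\mathcal{V}$ for every real $c$. *)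

theory Defs
  imports "HOL-Probability.Probability"
begin

definition compactly_supported :: "real measure \<Rightarrow> bool" where
  "compactly_supported \<nu> \<longleftrightarrow> (\<exists>K. compact K \<and> (AE x in \<nu>. x \<in> K))"

definition csk_generator :: "real measure \<Rightarrow> bool" where
  "csk_generator \<nu> \<longleftrightarrow>
     prob_space \<nu> \<and> sets \<nu> = sets borel \<and> compactly_supported \<nu> \<and>
     \<not> (\<exists>x0. AE x in \<nu>. x = x0) \<and>
     (LINT x|\<nu>. x) = 0"

definition csk_density :: "(real \<Rightarrow> real) \<Rightarrow> real \<Rightarrow> real \<Rightarrow> real" where
  "csk_density V x m = (if m = 0 then 1 else V m / (V m + m * (m - x)))"

text \<open>Since \<^const>\<open>ennreal\<close> truncates negative reals to 0, nonnegativity of the density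
  has to be required separately.\<close>

definition csk_prob :: "real measure \<Rightarrow> (real \<Rightarrow> real) \<Rightarrow> real \<Rightarrow> bool" where
  "csk_prob \<nu> V m \<longleftrightarrow>
     (AE x in \<nu>. 0 \<le> csk_density V x m) \<and>
     prob_space (density \<nu> (\<lambda>x. ennreal (csk_density V x m)))"

text \<open>The relation ``\<open>V\<close> is a representative of the germ at 0 of the variance function
  of \<open>\<nu>\<close>''. A convergent expansion at 0, which \<open>has_fps_expansion\<close> requires to agree with
  \<open>V\<close> only near 0, is real analyticity in a neighbourhood of 0. As \<open>V 0 \<noteq> 0\<close> and \<open>\<nu>\<close> has
  compact support, the denominator of the density is nonzero on the support for all small
  \<open>m\<close>, and the interval may be shrunk; so the convention \<open>x / 0 = 0\<close> plays no role.\<close>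

definition is_variance_function :: "real measure \<Rightarrow> (real \<Rightarrow> real) \<Rightarrow> bool" where
  "is_variance_function \<nu> V \<longleftrightarrow>
     csk_generator \<nu> \<and>
     (\<exists>F. V has_fps_expansion F) \<and> V 0 \<noteq> 0 \<and>
     (\<exists>m1 m2. m1 < 0 \<and> 0 < m2 \<and> (\<forall>m\<in>{m1<..<m2}. csk_prob \<nu> V m))"

text \<open>Both classes are closed under changing a function away from a neighbourhood of 0,
  so membership is a property of germs at 0.\<close>

definition variance_class :: "(real \<Rightarrow> real) set" where
  "variance_class = {V. \<exists>\<nu>. is_variance_function \<nu> V \<and> (LINT x|\<nu>. x\<^sup>2) = 1}"

definition variance_class_inf :: "(real \<Rightarrow> real) set" where
  "variance_class_inf =
     {V \<in> variance_class. \<forall>c::real. (\<lambda>m. V (c * m)) \<in> variance_class}"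

end

theory Submission
  imports Defs "HOL-Complex_Analysis.Complex_Analysis" "HOL-Real_Asymp.Real_Asymp"
begin

text \<open>Put \<open>V(m) = 1 + a m + b m\<^sup>2 + c m\<^sup>3\<close>, \<open>B = b + 1\<close> and \<open>P(m) = V(m) + m\<^sup>2 = 1 + a m + B m\<^sup>2 + c m\<^sup>3\<close>.
  With \<open>w = m / P(m)\<close> the density of the family is \<open>V(m) / P(m) / (1 - w x)\<close>, so it integrates to 1
  iff the moment generating function \<open>E(w) = \<integral> 1 / (1 - w x) \<nu>(dx)\<close> equals \<open>P(m) / V(m) = 1 / (1 - w m)\<close>.
  If \<open>g\<close> denotes the inverse function of \<open>m \<mapsto> m / P(m)\<close> and \<open>g(w) = w T(w)\<close>, this says
  \<open>E(w) = 1 / (1 - w\<^sup>2 T(w))\<close>: \<open>T\<close> should be the moment generating function of the measure with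
  R-transform \<open>a + B m + c m\<^sup>2\<close>, and \<open>\<nu>\<close> is obtained from that measure by adding one level to its
  continued fraction. The condition \<open>B\<^sup>3 \<ge> 27 c\<^sup>2\<close> is what makes this R-transform admissible.

  Necessity. Suppose \<open>B\<^sup>3 < 27 c\<^sup>2\<close>. The identity \<open>E(m / P(m)) V(m) / P(m) = 1\<close> holds for small
  real \<open>m\<close> and persists under analytic continuation as long as \<open>z = P(m) / m\<close> avoids the support of
  \<open>\<nu>\<close>. On a ray \<open>m = r e\<^sup>i\<^sup>\<theta>\<close> in the lower half plane, \<open>z\<close> stays in the upper half plane as long as
  \<open>1 - B r\<^sup>2 - 2 c r\<^sup>3 cos \<theta> > 0\<close>, and the assumption makes this true for all \<open>r > 0\<close> on a sector
  bounded by a real half line on which \<open>c m \<le> 0\<close> (\<open>cubic_sector_transversal\<close>). Going to infinity in that sector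
  contradicts \<open>E(w) = 1 + O(w\<^sup>2)\<close>, because \<open>\<nu>\<close> is centred (\<open>cubic_condition_if_variance_function\<close>).

  Sufficiency. Positivity is handled through moment sequences whose Hankel matrices are positive
  semidefinite. Such a sequence of at most geometric growth belongs to a compactly supported measure
  (\<open>bounded_hamburger\<close>). Let \<open>t\<^sup>3 = c\<close>, \<open>e = B - 3 t\<^sup>2 \<ge> 0\<close> and \<open>s = a - 3 t\<close>; then
  \<open>P(m) = (1 + t m)\<^sup>3 + s m + e m\<^sup>2\<close>.
  For \<open>s = e = 0\<close> the coefficients of \<open>T\<close> are \<open>t\<^sup>n\<close> times the numbers of ternary trees, which up to a
  geometric factor are products of moments of two beta distributions
  (\<open>positive_moments_ternary\<close>); call \<open>\<mu>\<close> the corresponding measure. The summands \<open>s m + e m\<^sup>2\<close>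
  amount to a translation and a free convolution with a semicircle law of variance \<open>e\<close>, and \<open>T\<close> is
  then the fixed point of \<open>T \<mapsto> \<integral> 1 / (1 - (x + s) w - e w\<^sup>2 T(w)) \<mu>(dx)\<close>
  (\<open>implicit_cubic_fixpoint\<close>). Each integrand is a continued fraction step, which preserves positivity by
  an operator model (\<open>positive_moments_jacobi_extension\<close>), hence so does the integral, and the
  fixed point is a coefficientwise limit of iterates (\<open>positive_moments_fixpoint\<close>). One further
  continued fraction step yields \<open>\<nu>\<close> (\<open>cubic_in_variance_class\<close>).

  The second equivalence follows from the first: replacing \<open>m\<close> by \<open>k m\<close> turns \<open>(b, c)\<close> into
  \<open>(b k\<^sup>2, c k\<^sup>3)\<close>, and \<open>(b k\<^sup>2 + 1)\<^sup>3 \<ge> 27 c\<^sup>2 k\<^sup>6\<close> for all \<open>k\<close> means \<open>b\<^sup>3 \<ge> 27 c\<^sup>2\<close>.\<close>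

(* The subscript notation for vectors would clash with that for coefficients of power series. *)
unbundle no vec_syntax

section \<open>Moment functionals and positivity of Hankel forms\<close>

definition moment_functional :: "(nat \<Rightarrow> real) \<Rightarrow> real poly \<Rightarrow> real" where
  "moment_functional m p = (\<Sum>i\<le>degree p. coeff p i * m i)"

lemma moment_functional_bound:
  assumes "degree p \<le> N"
  shows "moment_functional m p = (\<Sum>i\<le>N. coeff p i * m i)"
  unfolding moment_functional_def
  by (rule sum.mono_neutral_left) (use assms in \<open>auto simp: coeff_eq_0\<close>)

lemma moment_functional_add: "moment_functional m (p + q) = moment_functional m p + moment_functional m q"
proof -
  define N where "N = max (degree p) (degree q)"
  have "degree (p + q) \<le> N" "degree p \<le> N" "degree q \<le> N"
    unfolding N_def by (auto intro: degree_add_le)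
  then show ?thesis
    by (simp add: moment_functional_bound[where N = N] sum.distrib distrib_right)
qed

lemma moment_functional_smult: "moment_functional m (smult c p) = c * moment_functional m p"
  by (simp add: moment_functional_bound[where N = "degree p"] sum_distrib_left degree_smult_le mult_ac)

lemma moment_functional_0 [simp]: "moment_functional m 0 = 0"
  by (simp add: moment_functional_def)

lemma moment_functional_sum: "moment_functional m (\<Sum>i\<in>A. f i) = (\<Sum>i\<in>A. moment_functional m (f i))"
  by (induction A rule: infinite_finite_induct) (auto simp: moment_functional_add)

lemma moment_functional_monom [simp]: "moment_functional m (monom c n) = c * m n"
proof -
  have "moment_functional m (monom c n) = (\<Sum>i\<le>n. coeff (monom c n) i * m i)"
    by (rule moment_functional_bound) (rule degree_monom_le)
  also have "\<dots> = (\<Sum>i\<le>n. if n = i then c * m i else 0)"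
    by (rule sum.cong) auto
  also have "\<dots> = c * m n" by simp
  finally show ?thesis .
qed

lemma integral_poly_moments:
  assumes "\<And>n. integrable M (\<lambda>x. x ^ n)" and "\<And>n. (LINT x|M. x ^ n) = m n"
  shows "(LINT x|M. poly p x) = moment_functional m p"
  unfolding poly_altdef[abs_def] moment_functional_def
  by (auto simp: assms Bochner_Integration.integral_sum)

definition positive_moments :: "(nat \<Rightarrow> real) \<Rightarrow> bool" where
  "positive_moments m \<longleftrightarrow> (\<forall>q. 0 \<le> moment_functional m (q * q))"

lemma moment_functional_square:
  "moment_functional m ((\<Sum>i<n. monom (c i) i) * (\<Sum>i<n. monom (c i) i)) =
     (\<Sum>i<n. \<Sum>j<n. c i * c j * m (i + j))"
  by (simp add: sum_product mult_monom moment_functional_sum)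

lemma positive_moments_iff:
  "positive_moments m \<longleftrightarrow> (\<forall>n c. 0 \<le> (\<Sum>i<n. \<Sum>j<n. c i * c j * m (i + j)))"
proof
  assume "positive_moments m"
  then show "\<forall>n c. 0 \<le> (\<Sum>i<n. \<Sum>j<n. c i * c j * m (i + j))"
    unfolding positive_moments_def moment_functional_square[symmetric] by blast
next
  assume *: "\<forall>n c. 0 \<le> (\<Sum>i<n. \<Sum>j<n. c i * c j * m (i + j))"
  show "positive_moments m"
    unfolding positive_moments_def
  proof
    fix q :: "real poly"
    have "0 \<le> (\<Sum>i<Suc (degree q). \<Sum>j<Suc (degree q). coeff q i * coeff q j * m (i + j))"
      using * by blast
    then show "0 \<le> moment_functional m (q * q)"
      unfolding moment_functional_square[symmetric]
      by (simp only: lessThan_Suc_atMost poly_as_sum_of_monoms)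
  qed
qed

text \<open>The quadratic form on the span of \<open>1\<close> and \<open>x\<^sup>k\<close> is positive semidefinite. If \<open>m 0 = 0\<close>, the discriminant
  argument degenerates and a large multiple of \<open>1\<close> makes the form negative unless \<open>m k = 0\<close>.\<close>

lemma positive_moments_square_le:
  assumes "positive_moments m"
  shows "(m k)\<^sup>2 \<le> m 0 * m (2 * k)"
proof -
  have q: "0 \<le> s\<^sup>2 * m (2*k) + 2 * s * t * m k + t\<^sup>2 * m 0" for s t
  proof -
    have "0 \<le> moment_functional m ((monom s k + monom t 0) * (monom s k + monom t 0))"
      using assms unfolding positive_moments_def by blast
    also have "\<dots> = s\<^sup>2 * m (2*k) + 2 * s * t * m k + t\<^sup>2 * m 0"
      by (simp only: distrib_left distrib_right mult_monom moment_functional_add moment_functional_monom)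
         (simp add: power2_eq_square flip: mult_2)
    finally show ?thesis .
  qed
  have m0: "0 \<le> m 0" using q[of 0 1] by simp
  show ?thesis
  proof (cases "m 0 = 0")
    case False
    with q[of "m 0" "- m k"] have "0 \<le> m 0 * (m 0 * m (2*k) - (m k)\<^sup>2)"
      by (simp add: algebra_simps power2_eq_square)
    with m0 False show ?thesis by (simp add: zero_le_mult_iff)
  next
    case True
    have "m k = 0"
    proof (rule ccontr)
      assume "m k \<noteq> 0"
      have "0 \<le> m (2*k) + 2 * (- (m (2*k) + 1) / (2 * m k)) * m k"
        using q[of 1 "- (m (2*k) + 1) / (2 * m k)"] True by simp
      also have "\<dots> = -1" using \<open>m k \<noteq> 0\<close> by (simp add: field_simps)
      finally show False by simp
    qed
    with True show ?thesis by simp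
  qed
qed

text \<open>Iterating the Cauchy-Schwarz inequality bounds \<open>(\<bar>m 1\<bar> / m 0) ^ 2\<^sup>k\<close> by \<open>\<bar>m (2\<^sup>k)\<bar> / m 0\<close>, so growth of
  order \<open>R\<^sup>n\<close> forces \<open>\<bar>m 1\<bar> / m 0 \<le> R\<close>; the constant \<open>A\<close> disappears in the limit.\<close>

lemma positive_moments_first_le:
  assumes pos: "positive_moments m" and R: "0 < R" and bound: "\<And>n. \<bar>m n\<bar> \<le> A * R ^ n"
  shows "\<bar>m 1\<bar> \<le> R * m 0"
proof (rule ccontr)
  assume neg: "\<not> \<bar>m 1\<bar> \<le> R * m 0"
  have sq: "(m k)\<^sup>2 \<le> m 0 * m (2 * k)" for k by (rule positive_moments_square_le[OF pos])
  have "0 \<le> m 0" 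
    using pos[unfolded positive_moments_def, rule_format, of "monom 1 0"] by (simp only: mult_monom moment_functional_monom) simp
  moreover have "m 0 \<noteq> 0" using sq[of 1] neg by auto
  ultimately have m0: "0 < m 0" by simp
  define x where "x = \<bar>m 1\<bar> / (R * m 0)"
  have x: "1 < x" using neg m0 R by (simp add: x_def field_simps)
  have "x ^ (2 ^ k) \<le> \<bar>m (2 ^ k)\<bar> / (R ^ (2 ^ k) * m 0)" for k
  proof (induction k)
    case 0
    then show ?case by (simp add: x_def)
  next
    case (Suc k)
    let ?n = "2 ^ k :: nat"
    have "x ^ (2 ^ Suc k) = (x ^ ?n)\<^sup>2" by (simp add: power_mult[symmetric] mult.commute)
    also have "\<dots> \<le> (\<bar>m ?n\<bar> / (R ^ ?n * m 0))\<^sup>2"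
      by (intro power_mono Suc) (use x in auto)
    also have "\<dots> = (m ?n)\<^sup>2 / (R ^ (2 * ?n) * (m 0)\<^sup>2)"
      by (simp add: power_divide power_mult_distrib power_mult[symmetric] mult.commute)
    also have "\<dots> \<le> (m 0 * m (2 * ?n)) / (R ^ (2 * ?n) * (m 0)\<^sup>2)"
      by (intro divide_right_mono sq) (use R in auto)
    also have "\<dots> = m (2 ^ Suc k) / (R ^ (2 ^ Suc k) * m 0)"
      using m0 by (simp add: power2_eq_square)
    also have "\<dots> \<le> \<bar>m (2 ^ Suc k)\<bar> / (R ^ (2 ^ Suc k) * m 0)"
      by (intro divide_right_mono) (use R m0 in auto)
    finally show ?case .
  qed
  moreover have "\<bar>m n\<bar> / (R ^ n * m 0) \<le> A / m 0" for n
    using bound[of n] R m0 by (simp add: field_simps)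
  ultimately have le: "x ^ (2 ^ k) \<le> A / m 0" for k by (meson order_trans)
  obtain n where n: "A / m 0 < x ^ n" using real_arch_pow[OF x] by blast
  have "x ^ n \<le> x ^ (2 ^ n)" using x by (intro power_increasing) auto
  with n le[of n] show False by simp
qed

lemma moment_functional_mult_left:
  "moment_functional (\<lambda>n. moment_functional m (monom 1 n * r)) p = moment_functional m (p * r)"
proof -
  have "p * r = (\<Sum>i\<le>degree p. smult (coeff p i) (monom 1 i * r))"
    by (subst (1) poly_as_sum_of_monoms[symmetric])
       (simp add: sum_distrib_right smult_monom flip: mult_smult_left)
  then show ?thesis
    by (simp add: moment_functional_def[of "\<lambda>n. moment_functional m (monom 1 n * r)"]
         moment_functional_sum moment_functional_smult)
qed

text \<open>Growth of order \<open>R\<^sup>n\<close> must confine the measure to \<open>{-R..R}\<close>. The weighted sequence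
  \<open>n \<mapsto> L(x\<^sup>n q\<^sup>2)\<close> is again positive with the same growth rate, so the bound on first moments says
  \<open>\<bar>L(x q\<^sup>2)\<bar> \<le> R L(q\<^sup>2)\<close>.\<close>

lemma positive_moments_localize:
  assumes pos: "positive_moments m" and R: "0 < R" and bound: "\<And>n. \<bar>m n\<bar> \<le> A * R ^ n"
  shows "0 \<le> moment_functional m ([:R, 1:] * (q * q))" "0 \<le> moment_functional m ([:R, -1:] * (q * q))"
proof -
  define m' where "m' = (\<lambda>n. moment_functional m (monom 1 n * (q * q)))"
  have L: "moment_functional m' p = moment_functional m (p * (q * q))" for p
    unfolding m'_def by (rule moment_functional_mult_left)
  have pos': "positive_moments m'"
    unfolding positive_moments_def
  proof
    fix p
    have "moment_functional m' (p * p) = moment_functional m ((p * q) * (p * q))"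
      by (simp add: L mult_ac)
    then show "0 \<le> moment_functional m' (p * p)" using pos unfolding positive_moments_def by metis
  qed
  define A' where "A' = (\<Sum>i\<le>degree (q * q). \<bar>coeff (q * q) i\<bar> * (A * R ^ i))"
  have "\<bar>m' n\<bar> \<le> A' * R ^ n" for n
  proof -
    have "m' n = moment_functional m ((q * q) * monom 1 n)" by (simp add: m'_def mult_ac)
    also have "\<dots> = moment_functional (\<lambda>i. moment_functional m (monom 1 i * monom 1 n)) (q * q)"
      by (rule moment_functional_mult_left[symmetric])
    also have "\<dots> = (\<Sum>i\<le>degree (q * q). coeff (q * q) i * m (i + n))"
      by (simp add: moment_functional_def[of _ "q * q"] mult_monom)
    also have "\<bar>\<dots>\<bar> \<le> (\<Sum>i\<le>degree (q * q). \<bar>coeff (q * q) i * m (i + n)\<bar>)"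
      by (rule sum_abs)
    also have "\<dots> \<le> (\<Sum>i\<le>degree (q * q). \<bar>coeff (q * q) i\<bar> * (A * R ^ (i + n)))"
      by (intro sum_mono) (simp only: abs_mult, intro mult_left_mono bound, simp)
    also have "\<dots> = A' * R ^ n"
      unfolding A'_def sum_distrib_right by (rule sum.cong) (simp_all add: power_add)
    finally show ?thesis .
  qed
  then have le: "\<bar>m' 1\<bar> \<le> R * m' 0" by (intro positive_moments_first_le[OF pos' R])
  have e: "[:R, s:] = monom R 0 + monom s 1" for s :: real
    by (simp add: monom_0 monom_Suc)
  have "moment_functional m ([:R, s:] * (q * q)) = R * m' 0 + s * m' 1" for s
    unfolding e L[symmetric] by (simp add: moment_functional_add)
  from this[of 1] this[of "-1"] le show "0 \<le> moment_functional m ([:R, 1:] * (q * q))"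
    "0 \<le> moment_functional m ([:R, -1:] * (q * q))"
    by linarith+
qed

text \<open>Even powers are absorbed in a square; what remains is \<open>1\<close>, \<open>R + x\<close>, \<open>R - x\<close> or their product, and
  \<open>2 R (R + x) (R - x) = (R + x) (R - x)\<^sup>2 + (R - x) (R + x)\<^sup>2\<close> reduces the product to the linear
  factors.\<close>

lemma moment_functional_bernstein_nonneg:
  assumes pos: "positive_moments m" and R: "0 < R" and bound: "\<And>n. \<bar>m n\<bar> \<le> A * R ^ n"
  shows "0 \<le> moment_functional m ([:R, 1:] ^ k * [:R, -1:] ^ l)"
proof -
  let ?P = "[:R, 1:]" and ?Q = "[:R, -1:]"
  note loc = positive_moments_localize[OF pos R bound]
  have sq: "0 \<le> moment_functional m (q * q)" for q using pos unfolding positive_moments_def by metis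
  have double: "p ^ (2 * j) = p ^ j * p ^ j" for p :: "real poly" and j
    by (simp add: mult_2 power_add)
  consider (ee) i j where "k = 2 * i" "l = 2 * j" | (oe) i j where "k = Suc (2 * i)" "l = 2 * j"
    | (eo) i j where "k = 2 * i" "l = Suc (2 * j)" | (oo) i j where "k = Suc (2 * i)" "l = Suc (2 * j)"
    by (metis evenE oddE Suc_eq_plus1)
  then show ?thesis
  proof cases
    case ee
    have "?P ^ k * ?Q ^ l = (?P ^ i * ?Q ^ j) * (?P ^ i * ?Q ^ j)" unfolding ee double by (simp only: mult_ac)
    then show ?thesis using sq by metis
  next
    case oe
    have "?P ^ k * ?Q ^ l = ?P * ((?P ^ i * ?Q ^ j) * (?P ^ i * ?Q ^ j))" 
      unfolding oe double power_Suc by (simp only: mult_ac)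
    then show ?thesis using loc by metis
  next
    case eo
    have "?P ^ k * ?Q ^ l = ?Q * ((?P ^ i * ?Q ^ j) * (?P ^ i * ?Q ^ j))" 
      unfolding eo double power_Suc by (simp only: mult_ac)
    then show ?thesis using loc by metis
  next
    case oo
    define q where "q = ?P ^ i * ?Q ^ j"
    have "?P ^ k * ?Q ^ l = (?P * ?Q) * (q * q)" 
      unfolding oo double power_Suc q_def by (simp only: mult_ac)
    moreover have "smult (2 * R) (?P * ?Q) = ?P * (?Q * ?Q) + ?Q * (?P * ?P)"
      by (simp add: algebra_simps)
    ultimately have "smult (2 * R) (?P ^ k * ?Q ^ l) = (?P * (?Q * ?Q) + ?Q * (?P * ?P)) * (q * q)"
      by (simp only: mult_smult_left[symmetric])
    then have "smult (2 * R) (?P ^ k * ?Q ^ l) = ?P * ((?Q * q) * (?Q * q)) + ?Q * ((?P * q) * (?P * q))"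
      by (simp only: distrib_right distrib_left mult_ac)
    then have "2 * R * moment_functional m (?P ^ k * ?Q ^ l) =
        moment_functional m (?P * ((?Q * q) * (?Q * q))) + moment_functional m (?Q * ((?P * q) * (?P * q)))"
      by (metis moment_functional_add moment_functional_smult)
    then have "0 \<le> 2 * R * moment_functional m (?P ^ k * ?Q ^ l)" using loc by (metis add_nonneg_nonneg)
    then show ?thesis using R by (simp add: zero_le_mult_iff)
  qed
qed

section \<open>The Hamburger moment problem with geometric growth\<close>

text \<open>For \<open>p = x\<close>, \<open>q = 1 - x\<close> these are the factorial moments of the binomial distribution. They reproduce
  powers exactly, in contrast to the ordinary moments of the Bernstein weights.\<close>

lemma binomial_weights_factorial_moment:
  fixes p q :: "'a::comm_ring_1"
  assumes "p + q = 1" "j \<le> n"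
  shows "(\<Sum>k\<le>n. of_nat (n choose k) * of_nat (k choose j) * (p ^ k * q ^ (n - k))) = of_nat (n choose j) * p ^ j"
proof -
  have "(\<Sum>k\<le>n. of_nat (n choose k) * of_nat (k choose j) * (p ^ k * q ^ (n - k))) =
        (\<Sum>k\<in>{j..n}. of_nat (n choose k) * of_nat (k choose j) * (p ^ k * q ^ (n - k)))"
    by (rule sum.mono_neutral_right) (auto simp: binomial_eq_0)
  also have "\<dots> = (\<Sum>i\<le>n - j. of_nat (n choose j) * p ^ j * (of_nat (n - j choose i) * p ^ i * q ^ (n - j - i)))"
  proof (rule sum.reindex_bij_witness[of _ "\<lambda>i. i + j" "\<lambda>k. k - j"])
    fix k assume k: "k \<in> {j..n}"
    then have "(n choose k) * (k choose j) = (n choose j) * (n - j choose (k - j))"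
      by (intro choose_mult) auto
    then have "(of_nat (n choose k) * of_nat (k choose j) :: 'a) = of_nat (n choose j) * of_nat (n - j choose (k - j))"
      by (metis of_nat_mult)
    moreover have "p ^ k = p ^ j * p ^ (k - j)" using k by (simp flip: power_add)
    moreover have "n - j - (k - j) = n - k" using k by auto
    ultimately show "of_nat (n choose j) * p ^ j * (of_nat (n - j choose (k - j)) * p ^ (k - j) * q ^ (n - j - (k - j))) =
        of_nat (n choose k) * of_nat (k choose j) * (p ^ k * q ^ (n - k))"
      by (simp only: mult_ac)
  qed (use assms(2) in auto)
  also have "\<dots> = of_nat (n choose j) * p ^ j * (p + q) ^ (n - j)"
    by (simp add: binomial_ring sum_distrib_left)
  finally show ?thesis using assms by simp
qed

text \<open>Both quantities are products of \<open>j\<close> factors in \<open>[-1, 1]\<close> that differ by at most \<open>j / (n - j)\<close>, uniformly in \<open>k\<close>.\<close>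

lemma binomial_ratio_power_close:
  assumes "k \<le> n" "2 * j \<le> n" "0 < n"
  shows "\<bar>real (k choose j) / real (n choose j) - (real k / real n) ^ j\<bar> \<le> real j * (real j / real (n - j))"
proof -
  have fac: "real (a choose j) = (\<Prod>i<j. real a - real i) / fact j" for a
    by (simp add: binomial_gbinomial gbinomial_prod_rev atLeast0LessThan)
  have prod: "real (k choose j) / real (n choose j) = (\<Prod>i<j. (real k - real i) / (real n - real i))"
    unfolding fac by (simp add: prod_dividef)
  have "norm ((\<Prod>i<j. (real k - real i) / (real n - real i)) - (\<Prod>i<j. real k / real n))
      \<le> (\<Sum>i<j. norm ((real k - real i) / (real n - real i) - real k / real n))"
  proof (rule norm_prod_diff)
    fix i assume "i \<in> {..<j}"
    then have "\<bar>real k - real i\<bar> \<le> real n - real i" "0 < real n - real i" using assms by auto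
    then show "norm ((real k - real i) / (real n - real i)) \<le> 1" by simp
  qed (use assms in auto)
  also have "\<dots> \<le> (\<Sum>i<j. real j / real (n - j))"
  proof (rule sum_mono)
    fix i assume i: "i \<in> {..<j}"
    have "(real k - real i) / (real n - real i) - real k / real n =
        - (real i * (real n - real k) / (real n * (real n - real i)))"
      using i assms by (simp add: field_simps)
    then have "norm ((real k - real i) / (real n - real i) - real k / real n) =
        real i * (real n - real k) / (real n * (real n - real i))"
      using i assms by simp
    also have "\<dots> = (real i / (real n - real i)) * ((real n - real k) / real n)" by simp
    also have "\<dots> \<le> (real j / real (n - j)) * 1"
      using i assms by (intro mult_mono frac_le) (auto simp: of_nat_diff)
    finally show "norm ((real k - real i) / (real n - real i) - real k / real n) \<le> real j / real (n - j)" by simp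
  qed
  finally show ?thesis by (simp add: prod)
qed

lemma finite_distribution_exists:
  fixes w :: "nat \<Rightarrow> real" and x :: "nat \<Rightarrow> real"
  assumes "\<And>k. k \<le> n \<Longrightarrow> 0 \<le> w k" "(\<Sum>k\<le>n. w k) = 1"
  shows "\<exists>M. real_distribution M \<and> (\<forall>f\<in>borel_measurable borel. (LINT t|M. f t) = (\<Sum>k\<le>n. w k * f (x k)))
    \<and> (AE t in M. t \<in> x ` {..n})"
proof -
  define v where "v k = (if k \<le> n then w k else 0)" for k
  have nn: "0 \<le> v k" for k using assms(1) by (auto simp: v_def)
  have "(\<integral>\<^sup>+k. ennreal (v k) \<partial>count_space UNIV) = (\<integral>\<^sup>+k. ennreal (v k) \<partial>count_space {..n})"
    by (rule nn_integral_count_space_eq) (auto simp: v_def)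
  also have "\<dots> = (\<Sum>k\<le>n. ennreal (w k))" by (simp add: nn_integral_count_space_finite v_def)
  also have "\<dots> = 1" using assms by (subst sum_ennreal) auto
  finally have tot: "(\<integral>\<^sup>+k. ennreal (v k) \<partial>count_space UNIV) = 1" .
  define p where "p = embed_pmf v"
  have pmf: "pmf p k = v k" for k unfolding p_def by (rule pmf_embed_pmf[OF nn tot])
  define M where "M = distr (measure_pmf p) borel x"
  have "real_distribution M"
    unfolding M_def real_distribution_def real_distribution_axioms_def
    by (auto intro!: prob_space.prob_space_distr measure_pmf.prob_space_axioms)
  moreover have "(LINT t|M. f t) = (\<Sum>k\<le>n. w k * f (x k))" if [measurable]: "f \<in> borel_measurable borel" for f
  proof -
    have "(LINT t|M. f t) = (LINT k|measure_pmf p. f (x k))"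
      unfolding M_def by (subst integral_distr) auto
    also have "\<dots> = (\<Sum>k\<in>{..n}. f (x k) * pmf p k)"
      by (rule integral_measure_pmf_real) (auto simp: set_pmf_eq pmf v_def split: if_splits)
    finally show ?thesis by (simp add: pmf v_def mult.commute)
  qed
  moreover have "AE t in M. t \<in> x ` {..n}"
    unfolding M_def
    by (subst AE_distr_iff) (auto simp: AE_measure_pmf_iff set_pmf_eq pmf v_def intro!: borel_closed finite_imp_closed split: if_splits)
  ultimately show ?thesis by blast
qed

text \<open>Helly selection gives a weak limit along a subsequence. As \<open>t\<^sup>j\<close> is unbounded, the limit of the moments is
  taken for the truncation of \<open>t\<^sup>j\<close> to the unit interval, and the support of the limit is controlled by a
  bounded continuous function that vanishes exactly on that interval.\<close>

lemma weak_limit_of_bounded_supports: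
  assumes dist: "\<And>n. real_distribution (M n)" and supp: "\<And>n. AE t in M n. t \<in> {0..1}"
    and lim: "\<And>j::nat. (\<lambda>n. LINT t|M n. t ^ j) \<longlonglongrightarrow> c j"
  shows "\<exists>N. real_distribution N \<and> (AE t in N. t \<in> {0..1}) \<and> (\<forall>j. (LINT t|N. t ^ j) = c j)"
proof -
  have "tight M"
    unfolding tight_def
  proof (intro conjI allI impI dist)
    fix e :: real assume "0 < e"
    have "measure (M n) {-1<..1} = 1" for n
    proof -
      interpret real_distribution "M n" by (rule dist)
      have "prob {x \<in> space (M n). x \<in> {-1<..1}} = 1"
        by (subst prob_Collect_eq_1) (use supp[of n] in \<open>auto elim!: eventually_mono\<close>)
      moreover have "{x \<in> space (M n). x \<in> {-1<..1}} = {-1<..1}" by auto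
      ultimately show ?thesis by (simp only:)
    qed
    with \<open>0 < e\<close> show "\<exists>a b. a < b \<and> (\<forall>n. 1 - e < measure (M n) {a<..b})"
      by (intro exI[of _ "-1"] exI[of _ 1]) auto
  qed
  then obtain r N where r: "strict_mono (r :: nat \<Rightarrow> nat)" and N: "real_distribution N"
    and conv: "weak_conv_m (M \<circ> id \<circ> r) N"
    using tight_imp_convergent_subsubsequence[of M id] by (auto simp: strict_mono_id)
  interpret N: real_distribution N by fact
  have lim': "(\<lambda>n. LINT t|M (r n). f t) \<longlonglongrightarrow> (LINT t|N. f t)"
    if "continuous_on UNIV f" "\<And>x. \<bar>f x\<bar> \<le> B" for f :: "real \<Rightarrow> real" and B
  proof -
    have "(\<lambda>n. LINT t|(M \<circ> id \<circ> r) n. f t) \<longlonglongrightarrow> (LINT t|N. f t)"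
      by (rule weak_conv_imp_integral_bdd_continuous_conv[OF _ N conv, of _ B])
         (use that dist in \<open>auto simp: continuous_on_eq_continuous_at\<close>)
    then show ?thesis by simp
  qed
  define g where "g t = min 1 (max 0 (- t) + max 0 (t - 1))" for t :: real
  have g: "continuous_on UNIV g" "\<And>t. \<bar>g t\<bar> \<le> 1" "\<And>t. 0 \<le> g t"
    unfolding g_def by (auto intro!: continuous_intros)
  have [measurable]: "g \<in> borel_measurable borel" by (rule borel_measurable_continuous_onI) fact
  have "(LINT t|M (r n). g t) = 0" for n
  proof -
    interpret K: real_distribution "M (r n)" by (rule dist)
    have "AE t in M (r n). g t = 0"
      using supp[of "r n"] by (rule eventually_mono) (auto simp: g_def)
    then have "(LINT t|M (r n). g t) = (LINT t|M (r n). 0)"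
      by (intro integral_cong_AE) auto
    then show ?thesis by simp
  qed
  with lim'[OF g(1,2)] have g0: "(LINT t|N. g t) = 0" by (simp add: LIMSEQ_const_iff)
  have "integrable N g"
    by (rule N.integrable_const_bound[where B = 1]) (use g in auto)
  with g0 have "AE t in N. g t = 0"
    by (subst (asm) integral_nonneg_eq_0_iff_AE) (use g in auto)
  then have suppN: "AE t in N. t \<in> {0..1}"
    by (rule eventually_mono) (auto simp: g_def min_def max_def split: if_splits)
  moreover have "(LINT t|N. t ^ j) = c j" for j
  proof -
    define f where "f t = (max 0 (min 1 t)) ^ j" for t :: real
    have f: "continuous_on UNIV f" "\<And>t. \<bar>f t\<bar> \<le> 1"
      unfolding f_def by (auto intro!: continuous_intros simp: power_le_one abs_le_iff)
    have [measurable]: "f \<in> borel_measurable borel" by (rule borel_measurable_continuous_onI) fact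
    have eq: "(LINT t|K. f t) = (LINT t|K. t ^ j)" 
      if "real_distribution K" "AE t in K. t \<in> {0..1}" for K
    proof -
      interpret K: real_distribution K by fact
      show ?thesis
      proof (intro integral_cong_AE)
        show "AE t in K. f t = t ^ j"
          using that(2) by (rule eventually_mono) (auto simp: f_def)
      qed auto
    qed
    have "(\<lambda>n. LINT t|M (r n). t ^ j) \<longlonglongrightarrow> (LINT t|N. t ^ j)"
      using lim'[OF f] unfolding eq[OF dist supp] eq[OF N suppN] .
    moreover have "(\<lambda>n. LINT t|M (r n). t ^ j) \<longlonglongrightarrow> c j"
      using LIMSEQ_subseq_LIMSEQ[OF lim r] by (simp add: o_def)
    ultimately show ?thesis by (rule LIMSEQ_unique)
  qed
  ultimately show ?thesis using N by blast
qed

lemma pcompose_power: "pcompose (p ^ n) q = pcompose p q ^ n"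
  by (induction n) (simp_all add: pcompose_1 pcompose_mult)

text \<open>Bernstein's approach to the Hausdorff moment problem: after rescaling to the unit interval, the values of the
  functional on the Bernstein polynomials of degree \<open>n\<close> are probability weights at the points \<open>k / n\<close>,
  and the moments of these discrete distributions converge to the given ones.\<close>

theorem bounded_hamburger:
  assumes pos: "positive_moments m" and m0: "m 0 = 1" and R: "0 < R"
    and bound: "\<And>n. \<bar>m n\<bar> \<le> A * R ^ n"
  shows "\<exists>N. real_distribution N \<and> (AE t in N. \<bar>t\<bar> \<le> R) \<and> (\<forall>n. (LINT t|N. t ^ n) = m n)"
proof -
  let ?L = "moment_functional m"
  define P Q where "P = smult (1 / (2 * R)) [:R, 1:]" and "Q = smult (1 / (2 * R)) [:R, -1:]"
  have PQ: "P + Q = 1" using R by (simp add: P_def Q_def one_pCons)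
  define b where "b n k = real (n choose k) * ?L (P ^ k * Q ^ (n - k))" for n k
  have b_nonneg: "0 \<le> b n k" for n k
  proof -
    have "P ^ k * Q ^ l = smult ((1 / (2 * R)) ^ k * (1 / (2 * R)) ^ l) ([:R, 1:] ^ k * [:R, -1:] ^ l)" for l
      by (simp only: P_def Q_def smult_power mult_smult_left mult_smult_right smult_smult mult.commute)
    then show ?thesis
      using moment_functional_bernstein_nonneg[OF pos R bound] R
      by (simp add: b_def moment_functional_smult)
  qed
  have b_sum: "(\<Sum>k\<le>n. b n k * (real (k choose j) / real (n choose j))) = ?L (P ^ j)" if "j \<le> n" for n j
  proof -
    have [simp]: "(of_nat k :: real poly) * p = smult (real k) p" for k p
      by (simp add: of_nat_poly)
    have "(\<Sum>k\<le>n. real (n choose k) * real (k choose j) * ?L (P ^ k * Q ^ (n - k))) = real (n choose j) * ?L (P ^ j)"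
      using arg_cong[OF binomial_weights_factorial_moment[OF PQ that], of ?L]
      by (simp add: moment_functional_sum moment_functional_smult mult.assoc)
    then have "(\<Sum>k\<le>n. real (n choose k) * real (k choose j) * ?L (P ^ k * Q ^ (n - k))) / real (n choose j) = ?L (P ^ j)"
      using that by simp
    then show ?thesis by (simp add: b_def sum_divide_distrib mult_ac)
  qed
  have L1: "?L 1 = 1" using m0 moment_functional_monom[of m 1 0] by (simp add: monom_0 one_pCons)
  have b_total: "(\<Sum>k\<le>n. b n k) = 1" for n using b_sum[of 0 n] L1 by simp
  have "\<forall>n. \<exists>M. real_distribution M \<and> (\<forall>f\<in>borel_measurable borel. (LINT t|M. f t) = (\<Sum>k\<le>Suc n. b (Suc n) k * f (real k / real (Suc n))))
    \<and> (AE t in M. t \<in> (\<lambda>k. real k / real (Suc n)) ` {..Suc n})"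
    by (intro allI finite_distribution_exists b_nonneg b_total)
  from choice[OF this] obtain D where D': "\<forall>n. real_distribution (D n) \<and> (\<forall>f\<in>borel_measurable borel. (LINT t|D n. f t) = (\<Sum>k\<le>Suc n. b (Suc n) k * f (real k / real (Suc n))))
    \<and> (AE t in D n. t \<in> (\<lambda>k. real k / real (Suc n)) ` {..Suc n})" ..
  have D: "real_distribution (D n)"
      "f \<in> borel_measurable borel \<Longrightarrow> (LINT t|D n. f t) = (\<Sum>k\<le>Suc n. b (Suc n) k * f (real k / real (Suc n)))"
      "AE t in D n. t \<in> (\<lambda>k. real k / real (Suc n)) ` {..Suc n}" for n and f :: "real \<Rightarrow> real"
    using D'[rule_format, of n] by blast+
  have "\<exists>N. real_distribution N \<and> (AE t in N. t \<in> {0..1}) \<and> (\<forall>j. (LINT t|N. t ^ j) = ?L (P ^ j))"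
  proof (rule weak_limit_of_bounded_supports[OF D(1)])
    show "AE t in D n. t \<in> {0..1}" for n
      using D(3)[of n] by (rule eventually_mono) auto
    show "(\<lambda>n. LINT t|D n. t ^ j) \<longlonglongrightarrow> ?L (P ^ j)" for j
    proof -
      have "\<bar>(LINT t|D n. t ^ j) - ?L (P ^ j)\<bar> \<le> real j * (real j / real (Suc n - j))" if n: "2 * j \<le> n" for n
      proof -
        let ?N = "Suc n"
        have "(LINT t|D n. t ^ j) = (\<Sum>k\<le>?N. b ?N k * (real k / real ?N) ^ j)"
          by (rule D(2)) measurable
        moreover have "?L (P ^ j) = (\<Sum>k\<le>?N. b ?N k * (real (k choose j) / real (?N choose j)))"
          using n by (intro b_sum[symmetric]) auto
        ultimately have "\<bar>(LINT t|D n. t ^ j) - ?L (P ^ j)\<bar> =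
            \<bar>\<Sum>k\<le>?N. b ?N k * ((real k / real ?N) ^ j - real (k choose j) / real (?N choose j))\<bar>"
          by (simp only: right_diff_distrib sum_subtractf)
        also have "\<dots> \<le> (\<Sum>k\<le>?N. \<bar>b ?N k * ((real k / real ?N) ^ j - real (k choose j) / real (?N choose j))\<bar>)"
          by (rule sum_abs)
        also have "\<dots> \<le> (\<Sum>k\<le>?N. b ?N k * (real j * (real j / real (?N - j))))"
        proof (rule sum_mono)
          fix k assume "k \<in> {..?N}"
          then have "\<bar>real (k choose j) / real (?N choose j) - (real k / real ?N) ^ j\<bar> \<le> real j * (real j / real (?N - j))"
            using n by (intro binomial_ratio_power_close) auto
          then have "\<bar>(real k / real ?N) ^ j - real (k choose j) / real (?N choose j)\<bar> \<le> real j * (real j / real (?N - j))"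
            by (simp only: abs_minus_commute)
          from mult_left_mono[OF this b_nonneg[of ?N k]]
          show "\<bar>b ?N k * ((real k / real ?N) ^ j - real (k choose j) / real (?N choose j))\<bar> \<le>
              b ?N k * (real j * (real j / real (?N - j)))"
            using b_nonneg[of ?N k] by (simp only: abs_mult abs_of_nonneg)
        qed
        also have "\<dots> = real j * (real j / real (?N - j))"
          by (simp only: b_total mult_1 flip: sum_distrib_right)
        finally show ?thesis .
      qed
      then have ev: "eventually (\<lambda>n. norm ((LINT t|D n. t ^ j) - ?L (P ^ j)) \<le> real j * (real j / real (Suc n - j))) sequentially"
        unfolding eventually_sequentially by (intro exI[of _ "2 * j"]) simp
      have "(\<lambda>n. real j * (real j / real (Suc n))) \<longlonglongrightarrow> 0"
        by real_asymp
      then have "(\<lambda>n. real j * (real j / real (Suc (n + j) - j))) \<longlonglongrightarrow> 0" by (simp add: Suc_diff_le)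
      then have "(\<lambda>n. real j * (real j / real (Suc n - j))) \<longlonglongrightarrow> 0"
        by (rule LIMSEQ_offset)
      from Lim_null_comparison[OF ev this] show ?thesis by (rule LIM_zero_cancel)
    qed
  qed
  then obtain N where N: "real_distribution N" "AE t in N. t \<in> {0..1}" "\<And>j. (LINT t|N. t ^ j) = ?L (P ^ j)"
    by blast
  interpret N: real_distribution N by fact
  have intN: "integrable N (\<lambda>t. t ^ j)" for j
  proof (rule N.integrable_const_bound[where B = 1])
    show "AE t in N. norm (t ^ j) \<le> 1"
      using N(2) by (rule eventually_mono) (auto simp: power_le_one)
  qed auto
  have LP: "?L (pcompose p P) = moment_functional (\<lambda>j. ?L (P ^ j)) p" for p
  proof -
    have "pcompose p P = (\<Sum>i\<le>degree p. smult (coeff p i) (P ^ i))"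
      by (subst (1) poly_as_sum_of_monoms[symmetric])
         (simp add: pcompose_sum monom_altdef pcompose_smult pcompose_power pcompose_pCons)
    then show ?thesis
      by (simp add: moment_functional_sum moment_functional_smult moment_functional_def[of "\<lambda>j. ?L (P ^ j)"])
  qed
  define K where "K = distr N borel (\<lambda>t. 2 * R * t - R)"
  have "real_distribution K"
    unfolding K_def by (auto simp: real_distribution_def real_distribution_axioms_def intro!: N.prob_space_distr)
  moreover have "AE t in K. \<bar>t\<bar> \<le> R"
    unfolding K_def
  proof (subst AE_distr_iff)
    show "AE x in N. \<bar>2 * R * x - R\<bar> \<le> R"
      using N(2)
    proof (rule eventually_mono)
      fix x :: real assume x: "x \<in> {0..1}"
      then have "0 \<le> R * x" "R * x \<le> R * 1" using R by (auto intro: mult_left_mono)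
      then show "\<bar>2 * R * x - R\<bar> \<le> R" by (simp add: abs_le_iff)
    qed
  qed auto
  moreover have "(LINT t|K. t ^ n) = m n" for n
  proof -
    have e: "poly ([:-R, 2 * R:] ^ n) = (\<lambda>t. (2 * R * t - R) ^ n)"
      by (auto simp: fun_eq_iff poly_power algebra_simps)
    have "(LINT t|K. t ^ n) = (LINT t|N. poly ([:-R, 2 * R:] ^ n) t)"
      unfolding e K_def by (subst integral_distr) auto
    also have "\<dots> = moment_functional (\<lambda>j. ?L (P ^ j)) ([:-R, 2 * R:] ^ n)"
      by (rule integral_poly_moments[OF intN N(3)])
    also have "\<dots> = ?L (pcompose ([:-R, 2 * R:] ^ n) P)" by (rule LP[symmetric])
    also have "pcompose ([:-R, 2 * R:] ^ n) P = monom 1 n"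
      using R by (simp add: pcompose_power pcompose_pCons P_def monom_altdef)
    finally show ?thesis by simp
  qed
  ultimately show ?thesis by blast
qed

section \<open>Operations that preserve positivity\<close>

lemma positive_moments_mixture:
  assumes "\<And>x. positive_moments (n x)" and "\<And>k. integrable M (\<lambda>x. n x k)"
  shows "positive_moments (\<lambda>k. LINT x|M. n x k)"
  unfolding positive_moments_iff
proof (intro allI)
  fix K :: nat and c :: "nat \<Rightarrow> real"
  have "(\<Sum>i<K. \<Sum>j<K. c i * c j * (LINT x|M. n x (i + j))) =
      (LINT x|M. (\<Sum>i<K. \<Sum>j<K. c i * c j * n x (i + j)))"
    using assms(2) by (simp add: Bochner_Integration.integral_sum)
  also have "0 \<le> \<dots>"
    using assms(1) by (intro integral_nonneg_AE) (simp add: positive_moments_iff)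
  finally show "0 \<le> (\<Sum>i<K. \<Sum>j<K. c i * c j * (LINT x|M. n x (i + j)))" .
qed

text \<open>If \<open>a\<close> is the moment sequence of a weight \<open>W\<close>, the Hankel form of the product sequence is the integral over
  \<open>s\<close> of the Hankel form of \<open>b\<close> in the vector \<open>(c\<^sub>i s\<^sup>i)\<close>.\<close>

lemma positive_moments_weight:
  assumes "\<And>k. ((\<lambda>s. s ^ k * W s) has_integral a k) S" and "\<And>s. s \<in> S \<Longrightarrow> 0 \<le> W s"
    and b: "positive_moments b"
  shows "positive_moments (\<lambda>k. a k * b k)"
  unfolding positive_moments_iff
proof (intro allI)
  fix K :: nat and c :: "nat \<Rightarrow> real"
  have "((\<lambda>s. \<Sum>i<K. \<Sum>j<K. (c i * c j * b (i + j)) * (s ^ (i + j) * W s)) has_integral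
      (\<Sum>i<K. \<Sum>j<K. (c i * c j * b (i + j)) * a (i + j))) S"
    by (intro has_integral_sum finite_lessThan has_integral_mult_right assms(1))
  moreover have "0 \<le> (\<Sum>i<K. \<Sum>j<K. (c i * c j * b (i + j)) * (s ^ (i + j) * W s))" if "s \<in> S" for s
  proof -
    have "0 \<le> W s * (\<Sum>i<K. \<Sum>j<K. (c i * s ^ i) * (c j * s ^ j) * b (i + j))"
      using b[unfolded positive_moments_iff, rule_format, where n = K and c = "\<lambda>i. c i * s ^ i"] assms(2)[OF that]
      by (rule mult_nonneg_nonneg[rotated])
    also have "\<dots> = (\<Sum>i<K. \<Sum>j<K. (c i * c j * b (i + j)) * (s ^ (i + j) * W s))"
      by (simp add: sum_distrib_left power_add mult_ac)
    finally show ?thesis .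
  qed
  ultimately have "0 \<le> (\<Sum>i<K. \<Sum>j<K. (c i * c j * b (i + j)) * a (i + j))"
    by (rule has_integral_nonneg)
  then show "0 \<le> (\<Sum>i<K. \<Sum>j<K. c i * c j * (a (i + j) * b (i + j)))"
    by (simp add: mult_ac)
qed

lemma positive_moments_scale:
  assumes "positive_moments m"
  shows "positive_moments (\<lambda>k. t ^ k * m k)"
  unfolding positive_moments_iff
proof (intro allI)
  fix K :: nat and c :: "nat \<Rightarrow> real"
  have "0 \<le> (\<Sum>i<K. \<Sum>j<K. (c i * t ^ i) * (c j * t ^ j) * m (i + j))"
    using assms[unfolded positive_moments_iff, rule_format, where n = K and c = "\<lambda>i. c i * t ^ i"] .
  then show "0 \<le> (\<Sum>i<K. \<Sum>j<K. c i * c j * (t ^ (i + j) * m (i + j)))"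
    by (simp add: power_add mult_ac)
qed

lemma positive_moments_const_1: "positive_moments (\<lambda>_. 1)"
  unfolding positive_moments_iff
proof (intro allI)
  fix K :: nat and c :: "nat \<Rightarrow> real"
  have "(\<Sum>i<K. \<Sum>j<K. c i * c j * 1) = (\<Sum>i<K. c i) * (\<Sum>i<K. c i)"
    by (simp add: sum_product)
  then show "0 \<le> (\<Sum>i<K. \<Sum>j<K. c i * c j * 1)" by simp
qed

lemma positive_moments_local_limit:
  assumes "\<And>K::nat. \<exists>m'. positive_moments m' \<and> (\<forall>k<K. m' k = m k)"
  shows "positive_moments m"
  unfolding positive_moments_iff
proof (intro allI)
  fix K :: nat and c :: "nat \<Rightarrow> real"
  obtain m' where m': "positive_moments m'" "\<forall>k<2 * K. m' k = m k" using assms by blast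
  have "(\<Sum>i<K. \<Sum>j<K. c i * c j * m' (i + j)) = (\<Sum>i<K. \<Sum>j<K. c i * c j * m (i + j))"
    using m'(2) by (intro sum.cong refl) simp
  then show "0 \<le> (\<Sum>i<K. \<Sum>j<K. c i * c j * m (i + j))"
    using m'(1)[unfolded positive_moments_iff, rule_format, where n = K and c = c] by simp
qed

section \<open>Continued fraction steps\<close>

text \<open>If \<open>T\<close> is the moment generating function of \<open>\<tau>\<close>, this is the one of the measure whose Cauchy transform is
  \<open>1 / (z - x - e G(z))\<close> with \<open>G\<close> the Cauchy transform of \<open>\<tau>\<close>; its Jacobi matrix is that of \<open>\<tau>\<close>
  bordered by the diagonal entry \<open>x\<close> and the off-diagonal entry \<open>sqrt e\<close>.\<close>

definition jacobi_extension :: "real \<Rightarrow> real \<Rightarrow> real fps \<Rightarrow> real fps" where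
  "jacobi_extension x e T = inverse (1 - fps_const x * fps_X - fps_const e * fps_X\<^sup>2 * T)"

lemma jacobi_extension_nth:
  shows "jacobi_extension x e T $ 0 = 1"
    and "jacobi_extension x e T $ Suc k =
      x * jacobi_extension x e T $ k + e * (\<Sum>i<k. jacobi_extension x e T $ i * T $ (k - 1 - i))"
proof -
  let ?N = "jacobi_extension x e T" and ?D = "1 - fps_const x * fps_X - fps_const e * fps_X\<^sup>2 * T"
  have "?D $ 0 \<noteq> 0" by (simp add: power2_eq_square mult.assoc)
  then have "?N * ?D = 1" unfolding jacobi_extension_def by (rule inverse_mult_eq_1)
  then have N: "?N = 1 + fps_X * (fps_const x * ?N + fps_const e * (fps_X * (?N * T)))"
    by (simp add: algebra_simps power2_eq_square)
  show "?N $ 0 = 1" by (subst N) simp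
  have "?N $ Suc k = x * ?N $ k + e * (fps_X * (?N * T)) $ k" by (subst N) simp
  also have "(fps_X * (?N * T)) $ k = (\<Sum>i<k. ?N $ i * T $ (k - 1 - i))"
    unfolding fps_X_mult_nth by (cases k) (simp_all add: fps_mult_nth atLeast0AtMost lessThan_Suc_atMost)
  finally show "?N $ Suc k = x * ?N $ k + e * (\<Sum>i<k. ?N $ i * T $ (k - 1 - i))" .
qed

text \<open>The degree gained by the factor \<open>e X\<^sup>2\<close> is what makes the iteration towards a fixed point stabilize
  coefficient by coefficient.\<close>

lemma jacobi_extension_nth_cong:
  assumes "\<And>j. j < k \<Longrightarrow> T $ j = T' $ j" "i \<le> k"
  shows "jacobi_extension x e T $ i = jacobi_extension x e T' $ i"
  using assms(2)
proof (induction i rule: less_induct)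
  case (less i)
  show ?case
  proof (cases i)
    case 0
    then show ?thesis by (simp add: jacobi_extension_nth)
  next
    case (Suc l)
    have "(\<Sum>i<l. jacobi_extension x e T $ i * T $ (l - 1 - i)) =
        (\<Sum>i<l. jacobi_extension x e T' $ i * T' $ (l - 1 - i))"
      using less Suc by (intro sum.cong refl arg_cong2[of _ _ _ _ "(*)"] assms(1)) auto
    then show ?thesis using less Suc by (simp add: jacobi_extension_nth)
  qed
qed

text \<open>On pairs \<open>(r, p)\<close> of a number and a polynomial, with the semi-inner product
  \<open>r r' + L(p p')\<close>, the operator \<open>(r, p) \<mapsto> (x r + sqrt e L(p), sqrt e r + X p)\<close> is symmetric. Its powers
  applied to \<open>(1, 0)\<close> are \<open>(n\<^sub>k, p\<^sub>k)\<close> with \<open>n\<close> the coefficients of the extension, so symmetry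
  gives \<open>n\<^sub>j\<^sub>+\<^sub>k = n\<^sub>j n\<^sub>k + L(p\<^sub>j p\<^sub>k)\<close>, and the Hankel form is a squared norm.\<close>

lemma positive_moments_jacobi_extension:
  assumes T: "positive_moments (fps_nth T)" and e: "0 \<le> e"
  shows "positive_moments (fps_nth (jacobi_extension x e T))"
proof -
  let ?L = "moment_functional (fps_nth T)" and ?n = "fps_nth (jacobi_extension x e T)"
  \<comment> \<open>The polynomial components of the orbit of \<open>(1, 0)\<close>.\<close>
  define p where "p = rec_nat 0 (\<lambda>k q. monom (sqrt e * ?n k) 0 + monom 1 1 * q)"
  have p0: "p 0 = 0" and p_Suc: "p (Suc k) = monom (sqrt e * ?n k) 0 + monom 1 1 * p k" for k
    by (simp_all add: p_def)
  have p_sum: "p k = (\<Sum>i<k. monom (sqrt e * ?n i) (k - 1 - i))" for k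
  proof (induction k)
    case (Suc k)
    have "monom 1 1 * (\<Sum>i<k. monom (sqrt e * ?n i) (k - 1 - i)) = (\<Sum>i<k. monom (sqrt e * ?n i) (k - i))"
      unfolding sum_distrib_left by (intro sum.cong refl) (simp add: mult_monom Suc_diff_Suc)
    then show ?case by (simp add: p_Suc Suc.IH)
  qed (simp add: p0)
  have Lp: "sqrt e * ?L (p k) = e * (\<Sum>i<k. ?n i * T $ (k - 1 - i))" for k
  proof -
    have "?L (p k) = sqrt e * (\<Sum>i<k. ?n i * T $ (k - 1 - i))"
      by (simp add: p_sum moment_functional_sum sum_distrib_left mult.assoc)
    then have "sqrt e * ?L (p k) = (sqrt e * sqrt e) * (\<Sum>i<k. ?n i * T $ (k - 1 - i))"
      by (simp only: mult.assoc)
    then show ?thesis using e by simp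
  qed
  have n_Suc: "?n (Suc k) = x * ?n k + sqrt e * ?L (p k)" for k
    by (simp add: jacobi_extension_nth Lp)
  define B where "B j k = ?n j * ?n k + ?L (p j * p k)" for j k
  have B_shift: "B (Suc j) k = B j (Suc k)" for j k
  proof -
    have 1: "?L ((monom s 0 + monom 1 1 * q) * r) = s * ?L r + ?L (monom 1 1 * (q * r))" for s q r
      by (simp add: distrib_right moment_functional_add mult.assoc monom_0 moment_functional_smult)
    have "?L (p j * p (Suc k)) = ?L (p (Suc k) * p j)" by (simp only: mult.commute)
    also have "\<dots> = sqrt e * ?n k * ?L (p j) + ?L (monom 1 1 * (p k * p j))" by (simp only: p_Suc 1)
    also have "p k * p j = p j * p k" by (rule mult.commute)
    finally have 2: "?L (p j * p (Suc k)) = sqrt e * ?n k * ?L (p j) + ?L (monom 1 1 * (p j * p k))" .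
    show ?thesis
      unfolding B_def 2 by (simp only: p_Suc[of j] 1) (simp add: n_Suc algebra_simps)
  qed
  have "B j k = ?n (j + k)" for j k
  proof (induction j arbitrary: k)
    case 0
    show ?case by (simp add: B_def p0 jacobi_extension_nth)
  next
    case (Suc j)
    show ?case using B_shift[of j k] Suc.IH[of "Suc k"] by simp
  qed
  then have n_add: "?n (j + k) = ?n j * ?n k + ?L (p j * p k)" for j k by (simp add: B_def)
  show ?thesis
    unfolding positive_moments_iff
  proof (intro allI)
    fix K :: nat and c :: "nat \<Rightarrow> real"
    define q where "q = (\<Sum>i<K. smult (c i) (p i))"
    have "(\<Sum>i<K. \<Sum>j<K. c i * c j * ?n (i + j)) =
        (\<Sum>i<K. \<Sum>j<K. (c i * ?n i) * (c j * ?n j)) + (\<Sum>i<K. \<Sum>j<K. ?L (smult (c i) (p i) * smult (c j) (p j)))"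
      by (simp add: n_add moment_functional_smult algebra_simps sum.distrib)
    also have "\<dots> = (\<Sum>i<K. c i * ?n i) * (\<Sum>i<K. c i * ?n i) + ?L (q * q)"
      by (simp only: q_def sum_product moment_functional_sum)
    also have "0 \<le> \<dots>" using T unfolding positive_moments_def by (intro add_nonneg_nonneg) auto
    finally show "0 \<le> (\<Sum>i<K. \<Sum>j<K. c i * c j * ?n (i + j))" .
  qed
qed

section \<open>Beta moments and ternary trees\<close>

lemma beta_moments:
  assumes "0 < \<alpha>" "0 < \<beta>"
  shows "((\<lambda>s. s ^ k * (s powr (\<alpha> - 1) * (1 - s) powr (\<beta> - 1) / Beta \<alpha> \<beta>)) has_integral
    pochhammer \<alpha> k / pochhammer (\<alpha> + \<beta>) k) {0..1::real}"
proof -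
  have G: "0 < Gamma \<alpha>" "0 < Gamma \<beta>" "0 < Gamma (\<alpha> + \<beta>)" "0 < Gamma (\<alpha> + \<beta> + real k)" 
    using assms by (auto intro!: Gamma_real_pos)
  have nn: "\<alpha> \<notin> \<int>\<^sub>\<le>\<^sub>0" "\<alpha> + \<beta> \<notin> \<int>\<^sub>\<le>\<^sub>0" using assms by (auto elim!: nonpos_Ints_cases)
  have "((\<lambda>s. s powr (\<alpha> + real k - 1) * (1 - s) powr (\<beta> - 1)) has_integral Beta (\<alpha> + real k) \<beta>) {0..1}"
    using assms by (intro has_integral_Beta_real) auto
  then have "((\<lambda>s. (s powr (\<alpha> + real k - 1) * (1 - s) powr (\<beta> - 1)) / Beta \<alpha> \<beta>) has_integral
      Beta (\<alpha> + real k) \<beta> / Beta \<alpha> \<beta>) {0..1}"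
    by (rule has_integral_divide)
  moreover have "Beta (\<alpha> + real k) \<beta> / Beta \<alpha> \<beta> = pochhammer \<alpha> k / pochhammer (\<alpha> + \<beta>) k"
    using G nn by (simp add: Beta_def pochhammer_Gamma add_ac field_simps)
  ultimately have *: "((\<lambda>s. (s powr (\<alpha> + real k - 1) * (1 - s) powr (\<beta> - 1)) / Beta \<alpha> \<beta>) has_integral
      pochhammer \<alpha> k / pochhammer (\<alpha> + \<beta>) k) {0..1}" by simp
  show ?thesis
  proof (rule has_integral_spike_finite[OF _ _ *])
    show "finite {0::real}" by simp
    fix s :: real assume "s \<in> {0..1} - {0}"
    then have "0 < s" by auto
    then have "s powr (real k + (\<alpha> - 1)) = s ^ k * s powr (\<alpha> - 1)"
      by (simp only: powr_add powr_realpow)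
    then have "s powr (\<alpha> + real k - 1) = s ^ k * s powr (\<alpha> - 1)"
      by (simp add: algebra_simps)
    then show "s ^ k * (s powr (\<alpha> - 1) * (1 - s) powr (\<beta> - 1) / Beta \<alpha> \<beta>) =
        s powr (\<alpha> + real k - 1) * (1 - s) powr (\<beta> - 1) / Beta \<alpha> \<beta>" by simp
  qed
qed

text \<open>The quotients are the moments of the beta distribution with parameters \<open>\<alpha>\<close> and \<open>\<beta> - \<alpha>\<close>.\<close>

lemma positive_moments_pochhammer_ratio:
  fixes \<alpha> \<beta> :: real
  assumes "0 < \<alpha>" "\<alpha> < \<beta>" "positive_moments b"
  shows "positive_moments (\<lambda>k. pochhammer \<alpha> k / pochhammer \<beta> k * b k)"
proof (rule positive_moments_weight)
  show "((\<lambda>s. s ^ k * (s powr (\<alpha> - 1) * (1 - s) powr (\<beta> - \<alpha> - 1) / Beta \<alpha> (\<beta> - \<alpha>))) has_integral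
      pochhammer \<alpha> k / pochhammer \<beta> k) {0..1}" for k
    using beta_moments[of \<alpha> "\<beta> - \<alpha>" k] assms by simp
  show "0 \<le> s powr (\<alpha> - 1) * (1 - s) powr (\<beta> - \<alpha> - 1) / Beta \<alpha> (\<beta> - \<alpha>)" for s
    using assms by (auto simp: Beta_def intro!: divide_nonneg_nonneg mult_nonneg_nonneg less_imp_le[OF Gamma_real_pos])
qed (rule assms)

text \<open>The number of ternary trees with \<open>n + 1\<close> nodes, \<open>(3 n + 3 choose n + 1) / (2 n + 3)\<close>. In this form it
  is visibly a product of moments of two beta distributions.\<close>

definition ternary_coeff :: "nat \<Rightarrow> real" where
  "ternary_coeff n = (27 / 4) ^ n *
     (pochhammer (4 / 3) n / pochhammer 2 n * (pochhammer (5 / 3) n / pochhammer (5 / 2) n))"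

lemma positive_moments_ternary: "positive_moments (\<lambda>n. t ^ n * ternary_coeff n)"
proof -
  have "positive_moments (\<lambda>n. pochhammer (4 / 3) n / pochhammer 2 n *
      (pochhammer (5 / 3) n / pochhammer (5 / 2) n * 1))"
    by (intro positive_moments_pochhammer_ratio positive_moments_const_1) auto
  then show ?thesis
    unfolding ternary_coeff_def by (intro positive_moments_scale) simp
qed

lemma ternary_coeff_bounds: "0 \<le> ternary_coeff n" "ternary_coeff n \<le> (27 / 4) ^ n"
proof -
  have r: "0 \<le> pochhammer \<alpha> n / pochhammer \<beta> n \<and> pochhammer \<alpha> n / pochhammer \<beta> n \<le> 1"
    if "0 < \<alpha>" "\<alpha> \<le> \<beta>" for \<alpha> \<beta> :: real
  proof -
    have "pochhammer \<alpha> n \<le> pochhammer \<beta> n" unfolding pochhammer_prod using that by (intro prod_mono) auto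
    moreover have "0 < pochhammer \<alpha> n" "0 < pochhammer \<beta> n" using that by (auto intro!: pochhammer_pos)
    ultimately show ?thesis by simp
  qed
  let ?a = "pochhammer (4 / 3) n / pochhammer 2 n :: real" and ?b = "pochhammer (5 / 3) n / pochhammer (5 / 2) n :: real"
  have a: "0 \<le> ?a" "?a \<le> 1" and b: "0 \<le> ?b" "?b \<le> 1" using r[of "4/3" 2] r[of "5/3" "5/2"] by auto
  have ab: "0 \<le> ?a * ?b" by (rule mult_nonneg_nonneg[OF a(1) b(1)])
  have "?a * ?b \<le> 1 * 1" by (rule mult_mono) (use a b in simp_all)
  then have ab': "?a * ?b \<le> 1" by (simp only: mult_1)
  show "0 \<le> ternary_coeff n"
    unfolding ternary_coeff_def by (rule mult_nonneg_nonneg[OF _ ab]) simp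
  show "ternary_coeff n \<le> (27 / 4) ^ n"
    unfolding ternary_coeff_def by (rule mult_left_le[OF ab']) simp
qed

section \<open>Power series defined by an implicit equation\<close>

text \<open>The solution \<open>g\<close> of \<open>g = X P(g)\<close>, that is, the inverse of \<open>m \<mapsto> m / P(m)\<close>.\<close>

definition implicit_fps :: "real fps \<Rightarrow> real fps" where
  "implicit_fps P = fps_inv (fps_X * inverse P)"

lemma fps_X_mult_inverse_compose:
  fixes P h :: "real fps"
  assumes "P $ 0 \<noteq> 0" "h $ 0 = 0"
  shows "(fps_X * inverse P) oo h = h * inverse (P oo h)"
  using assms by (simp add: fps_compose_mult_distrib fps_inverse_compose)

lemma implicit_fps_nth_0: "implicit_fps P $ 0 = 0"
  by (simp add: implicit_fps_def fps_inv_def)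

lemma implicit_fps_eq:
  assumes "P $ 0 \<noteq> 0"
  shows "implicit_fps P = fps_X * (P oo implicit_fps P)"
proof -
  let ?g = "implicit_fps P"
  have "?g * inverse (P oo ?g) = fps_X"
    using fps_inv_right[of "fps_X * inverse P"] assms
    by (simp add: fps_X_mult_inverse_compose[OF assms implicit_fps_nth_0] flip: implicit_fps_def)
  then have "fps_X * (P oo ?g) = ?g * (inverse (P oo ?g) * (P oo ?g))" by (simp add: mult.assoc)
  also have "inverse (P oo ?g) * (P oo ?g) = 1" using assms by (intro inverse_mult_eq_1) simp
  finally show ?thesis by simp
qed

lemma implicit_fps_unique:
  assumes "P $ 0 \<noteq> 0" "h $ 0 = 0" "h = fps_X * (P oo h)"
  shows "h = implicit_fps P"
proof -
  let ?f = "fps_X * inverse P"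
  have "fps_X * ((P oo h) * inverse (P oo h)) = h * inverse (P oo h)"
    using assms(3) by (metis mult.assoc)
  moreover have "(P oo h) * inverse (P oo h) = 1"
    using assms(1) by (subst mult.commute, intro inverse_mult_eq_1) simp
  ultimately have "?f oo h = fps_X" by (simp add: fps_X_mult_inverse_compose[OF assms(1,2)])
  then have "implicit_fps P = implicit_fps P oo (?f oo h)" by simp
  also have "\<dots> = (implicit_fps P oo ?f) oo h" by (rule fps_compose_assoc) (use assms(2) in auto)
  also have "implicit_fps P oo ?f = fps_X" 
    unfolding implicit_fps_def by (rule fps_inv) (use assms(1) in auto)
  finally show ?thesis using assms(2) by simp
qed

text \<open>The series \<open>u = 1 + X U\<close>, with \<open>U\<close> the ternary series, is characterized by \<open>u = 1 + X u\<^sup>3\<close>. For the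
  solution of this equation, the Euler derivatives \<open>y = X u'\<close> and \<open>z = X y'\<close> are rational functions of \<open>u\<close>, and
  eliminating \<open>u\<close> leaves the hypergeometric equation \<open>4 z + 2 y = X (27 z + 27 y + 6 u)\<close>, which is
  the two-term recurrence of the coefficients.\<close>

lemma ternary_series: "Abs_fps ternary_coeff = (1 + fps_X * Abs_fps ternary_coeff) ^ 3"
proof -
  define g where "g = implicit_fps ((1 + fps_X) ^ 3)"
  have g0: "g $ 0 = 0" unfolding g_def by (rule implicit_fps_nth_0)
  have "(1 + fps_X) ^ 3 oo g = (1 + g) ^ 3"
    using g0 by (simp add: fps_compose_power[symmetric] fps_compose_add_distrib)
  moreover have "g = fps_X * ((1 + fps_X) ^ 3 oo g)"
    unfolding g_def by (rule implicit_fps_eq) (simp add: fps_power_zeroth)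
  ultimately have g: "fps_X * (1 + g) ^ 3 = g" by metis
  define u where "u = 1 + g"
  have u0: "u $ 0 = 1" by (simp add: u_def g0)
  have Xu: "fps_X * u ^ 3 = u - 1" using g by (simp add: u_def)
  define y where "y = fps_X * fps_deriv u"
  define z where "z = fps_X * fps_deriv y"
  have "fps_deriv u = fps_deriv (fps_X * u ^ 3)" by (simp add: Xu)
  also have "\<dots> = u ^ 3 + 3 * fps_X * u ^ 2 * fps_deriv u"
    by (simp add: fps_deriv_power' algebra_simps)
  finally have "u * y = u * (u - 1) + 3 * (u - 1) * y"
    unfolding y_def using Xu by algebra
  then have y: "(3 - 2 * u) * y = u * (u - 1)" by (simp add: algebra_simps)
  have "fps_deriv ((3 - 2 * u) * y) = fps_deriv (u * (u - 1))" by (simp only: y)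
  then have "- (2 * fps_deriv u) * y + (3 - 2 * u) * fps_deriv y = (2 * u - 1) * fps_deriv u"
    by (simp add: algebra_simps)
  then have z: "(3 - 2 * u) * z = (2 * u - 1) * y + 2 * y ^ 2"
    unfolding z_def using y_def by algebra
  have "(3 - 2 * u) ^ 3 * u ^ 3 * (4 * z + 2 * y) = (3 - 2 * u) ^ 3 * u ^ 3 * (fps_X * (27 * z + 27 * y + 6 * u))"
    using y z Xu by algebra
  moreover have "(3 - 2 * u) ^ 3 * u ^ 3 \<noteq> 0"
  proof -
    have "(3 - 2 * u) $ 0 \<noteq> 0" "u $ 0 \<noteq> 0" by (simp_all add: u0)
    then have "3 - 2 * u \<noteq> 0" "u \<noteq> 0" by (metis fps_zero_nth)+
    then show ?thesis by simp
  qed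
  ultimately have ode: "4 * z + 2 * y = fps_X * (27 * z + 27 * y + 6 * u)" by simp
  have y_nth: "y $ n = real n * u $ n" for n by (cases n) (simp_all add: y_def)
  have z_nth: "z $ n = real n ^ 2 * u $ n" for n by (cases n) (simp_all add: z_def y_nth power2_eq_square)
  have rec: "(4 * real (Suc n) ^ 2 + 2 * real (Suc n)) * u $ Suc n = (27 * real n ^ 2 + 27 * real n + 6) * u $ n" for n
    using arg_cong[OF ode, of "\<lambda>f. f $ Suc n"]
    by (simp add: y_nth z_nth numeral_fps_const algebra_simps del: of_nat_Suc)
  have u_nth: "u $ Suc n = ternary_coeff n" for n
  proof (induction n)
    case 0
    show ?case using rec[of 0] by (simp add: u0 ternary_coeff_def)
  next
    case (Suc n)
    have ne: "4 * real (Suc (Suc n)) ^ 2 + 2 * real (Suc (Suc n)) \<noteq> 0"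
      by (simp add: add_pos_pos pos_add_strict less_imp_neq[symmetric])
    have "(4 * real (Suc (Suc n)) ^ 2 + 2 * real (Suc (Suc n))) * ternary_coeff (Suc n) =
        (27 * real (Suc n) ^ 2 + 27 * real (Suc n) + 6) * ternary_coeff n"
    proof -
      have pos: "0 < pochhammer 2 n * pochhammer (5 / 2 :: real) n" by (auto intro!: mult_pos_pos pochhammer_pos)
      show ?thesis
        using pos by (simp add: ternary_coeff_def pochhammer_Suc divide_simps) (simp add: algebra_simps power2_eq_square)
    qed
    with rec[of "Suc n"] Suc.IH ne show ?case by (metis mult_left_cancel)
  qed
  have "u = 1 + fps_X * Abs_fps ternary_coeff"
  proof (rule fps_ext)
    fix n show "u $ n = (1 + fps_X * Abs_fps ternary_coeff) $ n" by (cases n) (simp_all add: u0 u_nth)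
  qed
  then have U: "u - 1 = fps_X * Abs_fps ternary_coeff" "u = 1 + fps_X * Abs_fps ternary_coeff" by simp_all
  have "fps_X * Abs_fps ternary_coeff = fps_X * u ^ 3" using U(1) Xu by simp
  then have "Abs_fps ternary_coeff = u ^ 3" by simp
  then show ?thesis using U(2) by simp
qed

text \<open>The ternary series after the substitution of \<open>t X\<close> for \<open>X\<close>.\<close>

lemma implicit_fps_cube:
  "implicit_fps ((1 + fps_const t * fps_X) ^ 3) = fps_X * Abs_fps (\<lambda>n. t ^ n * ternary_coeff n)"
proof (rule implicit_fps_unique[symmetric])
  let ?U = "Abs_fps ternary_coeff" and ?tX = "fps_const t * fps_X"
  have eq: "Abs_fps (\<lambda>n. t ^ n * ternary_coeff n) = ?U oo ?tX" by (simp add: fps_compose_linear)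
  have "?U oo ?tX = (1 + fps_X * ?U) ^ 3 oo ?tX" by (subst ternary_series) simp
  also have "\<dots> = (1 + fps_const t * (fps_X * (?U oo ?tX))) ^ 3"
    by (simp add: fps_compose_power[symmetric] fps_compose_add_distrib fps_compose_mult_distrib mult.assoc)
  also have "\<dots> = (1 + ?tX) ^ 3 oo (fps_X * (?U oo ?tX))"
    by (simp add: fps_compose_power[symmetric] fps_compose_add_distrib fps_compose_mult_distrib)
  finally show "fps_X * Abs_fps (\<lambda>n. t ^ n * ternary_coeff n) =
      fps_X * ((1 + ?tX) ^ 3 oo (fps_X * Abs_fps (\<lambda>n. t ^ n * ternary_coeff n)))"
    unfolding eq by (rule arg_cong)
qed (simp_all add: fps_power_zeroth)

section \<open>Translation and free convolution with a semicircle law\<close>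

text \<open>If \<open>M\<close> has Cauchy transform \<open>G\<^sub>M\<close> and \<open>T\<close> belongs to the Cauchy transform \<open>G\<close>, this series belongs to
  \<open>G\<^sub>M(z - s - e G(z))\<close>. The fixed points of this map describe the translate by \<open>s\<close> of the free convolution of \<open>M\<close> with
  the semicircle law of variance \<open>e\<close>.\<close>

definition averaged_extension :: "real measure \<Rightarrow> real \<Rightarrow> real \<Rightarrow> real fps \<Rightarrow> real fps" where
  "averaged_extension M s e T = Abs_fps (\<lambda>k. LINT x|M. jacobi_extension (x + s) e T $ k)"

text \<open>Expanding \<open>1 / (D - x X)\<close> as a geometric series in \<open>x X / D\<close> shows that each coefficient is a polynomial in \<open>x\<close>,
  so that it can be averaged over \<open>x\<close> in terms of moments.\<close>

lemma jacobi_extension_expand: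
  assumes D: "D = 1 - fps_const s * fps_X - fps_const e * fps_X\<^sup>2 * T"
  shows "jacobi_extension (x + s) e T $ k =
    (\<Sum>i=0..k. inverse D $ i * (\<Sum>j=0..k-i. x ^ j * ((fps_X * inverse D) ^ j) $ (k - i)))"
proof -
  let ?Y = "fps_X * inverse D" and ?G = "Abs_fps (\<lambda>j. x ^ j)"
  have D0: "D $ 0 \<noteq> 0" by (simp add: D power2_eq_square mult.assoc)
  have "(1 - fps_const x * fps_X) * ?G = 1"
  proof (rule fps_ext)
    fix n show "((1 - fps_const x * fps_X) * ?G) $ n = 1 $ n"
      by (cases n) (simp_all add: left_diff_distrib mult.assoc)
  qed
  then have "((1 - fps_const x * fps_X) * ?G) oo ?Y = 1" by simp
  then have G: "(1 - fps_const x * ?Y) * (?G oo ?Y) = 1"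
    by (simp add: fps_compose_mult_distrib fps_compose_sub_distrib)
  have "(D - fps_const x * fps_X) * (inverse D * (?G oo ?Y)) = (D * inverse D - fps_const x * ?Y) * (?G oo ?Y)"
    by (simp add: algebra_simps)
  also have "D * inverse D = 1" using inverse_mult_eq_1[OF D0] by (simp add: mult.commute)
  also note G
  finally have "inverse (D - fps_const x * fps_X) = inverse D * (?G oo ?Y)" by (rule fps_inverse_unique)
  moreover have "jacobi_extension (x + s) e T = inverse (D - fps_const x * fps_X)"
    unfolding jacobi_extension_def D by (rule arg_cong[of _ _ inverse]) (simp add: algebra_simps flip: fps_const_add)
  ultimately have "jacobi_extension (x + s) e T = inverse D * (?G oo ?Y)" by simp
  then show ?thesis by (simp add: fps_mult_nth fps_compose_nth)
qed

context
  fixes M :: "real measure" and u :: "nat \<Rightarrow> real"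
  assumes moments_integrable: "\<And>n. integrable M (\<lambda>x. x ^ n)" and moments: "\<And>n. (LINT x|M. x ^ n) = u n"
begin

lemma integrable_jacobi_extension: "integrable M (\<lambda>x. jacobi_extension (x + s) e T $ k)"
  by (simp add: jacobi_extension_expand[OF refl] moments_integrable)

lemma averaged_extension_eq:
  assumes D: "D = 1 - fps_const s * fps_X - fps_const e * fps_X\<^sup>2 * T"
  shows "averaged_extension M s e T = inverse D * (Abs_fps u oo (fps_X * inverse D))"
proof (rule fps_ext)
  fix k
  show "averaged_extension M s e T $ k = (inverse D * (Abs_fps u oo (fps_X * inverse D))) $ k"
    unfolding averaged_extension_def fps_nth_Abs_fps jacobi_extension_expand[OF D]
    by (simp add: fps_mult_nth fps_compose_nth moments_integrable moments Bochner_Integration.integral_sum)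
qed

lemma positive_moments_averaged_extension:
  assumes "positive_moments (fps_nth T)" "0 \<le> e"
  shows "positive_moments (fps_nth (averaged_extension M s e T))"
  unfolding averaged_extension_def fps_nth_Abs_fps
  by (intro positive_moments_mixture positive_moments_jacobi_extension assms integrable_jacobi_extension)

text \<open>Iterating the map from the series \<open>1\<close>, the moments of the point mass at 0, keeps positivity. After \<open>r\<close> steps
  the coefficients up to degree \<open>r\<close> agree with those of the fixed point.\<close>

lemma positive_moments_fixpoint:
  assumes T: "T = averaged_extension M s e T" and e: "0 \<le> e" and u0: "u 0 = 1"
  shows "positive_moments (fps_nth T)"
proof (rule positive_moments_local_limit)
  fix K :: nat
  let ?A = "averaged_extension M s e"
  have nth_0: "?A S $ 0 = 1" for S
    using moments[of 0] u0 by (simp add: averaged_extension_def jacobi_extension_nth)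
  have pos: "positive_moments (fps_nth ((?A ^^ r) 1))" for r
  proof (induction r)
    case 0
    have "(\<lambda>k. 0 ^ k * 1) = fps_nth (1 :: real fps)" by (auto simp: fun_eq_iff power_0_left)
    then show ?case using positive_moments_scale[OF positive_moments_const_1, of 0] by simp
  qed (simp add: positive_moments_averaged_extension e)
  have agree: "\<forall>k\<le>r. (?A ^^ r) 1 $ k = T $ k" for r
  proof (induction r)
    case 0
    show ?case using nth_0[of T] T by simp
  next
    case (Suc r)
    show ?case
    proof (intro allI impI)
      fix k assume "k \<le> Suc r"
      then have "jacobi_extension (x + s) e ((?A ^^ r) 1) $ k = jacobi_extension (x + s) e T $ k" for x
        using Suc.IH by (intro jacobi_extension_nth_cong[where k = k]) auto
      then have "?A ((?A ^^ r) 1) $ k = ?A T $ k" by (simp add: averaged_extension_def)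
      then show "(?A ^^ Suc r) 1 $ k = T $ k" using T by simp
    qed
  qed
  show "\<exists>m'. positive_moments m' \<and> (\<forall>k<K. m' k = T $ k)"
    using pos[of K] agree[of K] by (intro exI[of _ "fps_nth ((?A ^^ K) 1)"]) auto
qed

end

section \<open>Moment sequences with a quadratic R-transform\<close>

definition cubic_fps :: "real \<Rightarrow> real \<Rightarrow> real \<Rightarrow> real fps" where
  "cubic_fps a b c = 1 + fps_const a * fps_X + fps_const b * fps_X ^ 2 + fps_const c * fps_X ^ 3"

lemma cubic_fps_nth_0 [simp]: "cubic_fps a b c $ 0 = 1"
  by (simp add: cubic_fps_def fps_power_zeroth)

lemma cubic_fps_compose:
  "h $ 0 = 0 \<Longrightarrow> cubic_fps a b c oo h = 1 + fps_const a * h + fps_const b * h ^ 2 + fps_const c * h ^ 3"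
  unfolding cubic_fps_def
  by (simp add: fps_compose_add_distrib fps_compose_mult_distrib fps_compose_power[symmetric])

lemma integrable_power_bounded:
  assumes "real_distribution M" and "AE x in M. \<bar>x\<bar> \<le> R"
  shows "integrable M (\<lambda>x. x ^ n)"
proof -
  interpret real_distribution M by fact
  show ?thesis
  proof (rule integrable_const_bound[where B = "R ^ n"])
    show "AE x in M. norm (x ^ n) \<le> R ^ n"
      using assms(2) by (rule eventually_mono) (simp add: power_abs power_mono)
  qed auto
qed

text \<open>This is where the cubic condition enters: it leaves a nonnegative variance \<open>b - 3 t\<^sup>2\<close>, for
  \<open>t\<^sup>3 = c\<close>, to the semicircle law.\<close>

lemma cubic_split:
  fixes b c :: real
  assumes "27 * c\<^sup>2 \<le> b ^ 3"
  shows "3 * (root 3 c)\<^sup>2 \<le> b"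
proof -
  define t where "t = root 3 c"
  have t: "t ^ 3 = c" by (simp add: t_def odd_real_root_pow)
  have "(3 * t\<^sup>2) ^ 3 = 27 * (t ^ 3)\<^sup>2" by (simp add: power_mult_distrib flip: power_mult)
  then have le: "(3 * t\<^sup>2) ^ 3 \<le> b ^ 3" using assms t by simp
  have "0 \<le> b ^ 3" using assms by (rule order_trans[rotated]) simp
  then have "0 \<le> b" by (simp add: zero_le_power_eq)
  then show ?thesis using le power_mono_iff[of "3 * t\<^sup>2" b 3] by (simp add: t_def)
qed

text \<open>Here \<open>P(m) = (1 + t m)\<^sup>3 + s m + e m\<^sup>2\<close>. For its inverse \<open>g = X T\<close> and
  \<open>D = 1 - s X - e X g\<close>, the equation \<open>g = X P(g)\<close> becomes \<open>D g = X (1 + t g)\<^sup>3\<close>, so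
  \<open>X / D = g / (1 + t g)\<^sup>3\<close>. The inverse of \<open>m \<mapsto> m / (1 + t m)\<^sup>3\<close> therefore maps \<open>X / D\<close> to \<open>g\<close>, and
  this is the fixed point equation.\<close>

lemma implicit_cubic_fixpoint:
  fixes t s e :: real
  assumes M: "\<And>n. integrable M (\<lambda>x. x ^ n)" "\<And>n. (LINT x|M. x ^ n) = t ^ n * ternary_coeff n"
  defines "T \<equiv> fps_shift 1 (implicit_fps (cubic_fps (3 * t + s) (3 * t\<^sup>2 + e) (t ^ 3)))"
  shows "T = averaged_extension M s e T"
proof -
  define g where "g = implicit_fps (cubic_fps (3 * t + s) (3 * t\<^sup>2 + e) (t ^ 3))"
  let ?P = "(1 + fps_const t * fps_X) ^ 3" and ?Q = "(1 + fps_const t * g) ^ 3"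
  have g0: "g $ 0 = 0" unfolding g_def by (rule implicit_fps_nth_0)
  have XT: "fps_X * T = g"
  proof (rule fps_ext)
    fix n show "(fps_X * T) $ n = g $ n" using g0 by (cases n) (simp_all add: T_def g_def)
  qed
  define D where "D = 1 - fps_const s * fps_X - fps_const e * fps_X\<^sup>2 * T"
  let ?Y = "fps_X * inverse D" and ?U = "Abs_fps (\<lambda>n. t ^ n * ternary_coeff n)"
  have D0: "D $ 0 \<noteq> 0" by (simp add: D_def power2_eq_square mult.assoc)
  have Q0: "?Q $ 0 \<noteq> 0" by (simp add: fps_power_zeroth g0)
  have PQ: "?P oo g = ?Q"
    using g0 by (simp add: fps_compose_add_distrib fps_compose_mult_distrib fps_compose_power[symmetric])
  have "g = fps_X * (1 + fps_const (3 * t + s) * g + fps_const (3 * t\<^sup>2 + e) * g ^ 2 + fps_const (t ^ 3) * g ^ 3)"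
    unfolding cubic_fps_compose[OF g0, symmetric] unfolding g_def by (rule implicit_fps_eq) simp
  moreover have "?Q = 1 + fps_const (3 * t) * g + fps_const (3 * t\<^sup>2) * g ^ 2 + fps_const (t ^ 3) * g ^ 3"
    unfolding fps_const_mult[symmetric] fps_const_power[symmetric]
    by (simp add: power3_eq_cube power2_eq_square algebra_simps numeral_fps_const[symmetric])
  ultimately have "g = fps_X * (?Q + fps_const s * g + fps_const e * g\<^sup>2)"
    by (simp only: fps_const_add[symmetric] distrib_right add_ac)
  moreover have "D * g = g - fps_X * (fps_const s * g + fps_const e * g\<^sup>2)"
    unfolding D_def XT[symmetric] by (simp add: algebra_simps power2_eq_square)
  ultimately have Dg: "D * g = fps_X * ?Q" by algebra
  have "g * inverse ?Q = (inverse D * D) * g * inverse ?Q" using inverse_mult_eq_1[OF D0] by simp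
  also have "\<dots> = inverse D * (D * g) * inverse ?Q" by (simp only: mult.assoc)
  also have "\<dots> = ?Y * (inverse ?Q * ?Q)" unfolding Dg by (simp only: mult_ac)
  also have "inverse ?Q * ?Q = 1" by (rule inverse_mult_eq_1[OF Q0])
  finally have Y: "?Y = (fps_X * inverse ?P) oo g"
    by (simp add: fps_X_mult_inverse_compose[OF _ g0] PQ fps_power_zeroth)
  have "fps_X * (inverse D * (?U oo ?Y)) = (fps_X * ?U) oo ?Y"
    by (simp add: fps_compose_mult_distrib mult.assoc)
  also have "\<dots> = implicit_fps ?P oo ((fps_X * inverse ?P) oo g)"
    unfolding implicit_fps_cube[symmetric] Y ..
  also have "\<dots> = (implicit_fps ?P oo (fps_X * inverse ?P)) oo g"
    by (rule fps_compose_assoc) (simp_all add: g0)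
  also have "implicit_fps ?P oo (fps_X * inverse ?P) = fps_X"
    unfolding implicit_fps_def by (rule fps_inv) (simp_all add: fps_power_zeroth)
  finally have "fps_X * (inverse D * (?U oo ?Y)) = fps_X * T" using g0 XT by simp
  then show ?thesis by (simp add: averaged_extension_eq[OF M D_def])
qed

lemma positive_moments_cubic:
  assumes "27 * c\<^sup>2 \<le> b ^ 3"
  shows "positive_moments (fps_nth (fps_shift 1 (implicit_fps (cubic_fps a b c))))"
proof -
  define t where "t = root 3 c"
  define e where "e = b - 3 * t\<^sup>2"
  define s where "s = a - 3 * t"
  define R where "R = \<bar>t\<bar> * (27 / 4) + 1"
  have t: "t ^ 3 = c" by (simp add: t_def odd_real_root_pow)
  have e: "0 \<le> e" using cubic_split[OF assms] by (simp add: e_def t_def)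
  have "\<exists>M. real_distribution M \<and> (AE x in M. \<bar>x\<bar> \<le> R) \<and> (\<forall>n. (LINT x|M. x ^ n) = t ^ n * ternary_coeff n)"
  proof (rule bounded_hamburger[OF positive_moments_ternary])
    show "\<bar>t ^ n * ternary_coeff n\<bar> \<le> 1 * R ^ n" for n
    proof -
      have "\<bar>t ^ n * ternary_coeff n\<bar> = \<bar>t\<bar> ^ n * ternary_coeff n"
        using ternary_coeff_bounds(1)[of n] by (simp add: abs_mult power_abs)
      also have "\<dots> \<le> \<bar>t\<bar> ^ n * (27 / 4) ^ n" using ternary_coeff_bounds(2)[of n] by (rule mult_left_mono) simp
      also have "\<dots> = (\<bar>t\<bar> * (27 / 4)) ^ n" by (simp only: power_mult_distrib)
      also have "\<dots> \<le> R ^ n" unfolding R_def by (rule power_mono) simp_all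
      finally show ?thesis by simp
    qed
  qed (simp_all add: ternary_coeff_def R_def add_nonneg_pos)
  then obtain M where M: "real_distribution M" "AE x in M. \<bar>x\<bar> \<le> R" "\<And>n. (LINT x|M. x ^ n) = t ^ n * ternary_coeff n"
    by blast
  note int = integrable_power_bounded[OF M(1,2)]
  have eq: "cubic_fps a b c = cubic_fps (3 * t + s) (3 * t\<^sup>2 + e) (t ^ 3)"
    by (simp add: t e_def s_def)
  show ?thesis
    unfolding eq
    by (rule positive_moments_fixpoint[OF int M(3) implicit_cubic_fixpoint[OF int M(3)] e]) (simp add: ternary_coeff_def)
qed

section \<open>Geometric growth\<close>

lemma fps_mult_dominated:
  fixes f g F G :: "real fps"
  assumes "\<And>k. k \<le> n \<Longrightarrow> \<bar>f $ k\<bar> \<le> F $ k" "\<And>k. k \<le> n \<Longrightarrow> \<bar>g $ k\<bar> \<le> G $ k"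
  shows "\<bar>(f * g) $ n\<bar> \<le> (F * G) $ n"
proof -
  have "\<bar>(f * g) $ n\<bar> \<le> (\<Sum>i=0..n. \<bar>f $ i * g $ (n - i)\<bar>)"
    unfolding fps_mult_nth by (rule sum_abs)
  also have "\<dots> \<le> (\<Sum>i=0..n. F $ i * G $ (n - i))"
  proof (rule sum_mono)
    fix i assume "i \<in> {0..n}"
    then have "\<bar>f $ i\<bar> \<le> F $ i" "\<bar>g $ (n - i)\<bar> \<le> G $ (n - i)" using assms by auto
    then show "\<bar>f $ i * g $ (n - i)\<bar> \<le> F $ i * G $ (n - i)"
      unfolding abs_mult by (intro mult_mono) auto
  qed
  finally show ?thesis by (simp add: fps_mult_nth)
qed

text \<open>The coefficients are dominated by those of the solution \<open>h\<close> of \<open>h = A X (1 + h)\<^sup>3\<close>, which are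
  \<open>A\<^sup>n\<^sup>+\<^sup>1\<close> times the ternary numbers.\<close>

lemma implicit_cubic_bound:
  fixes a b c :: real
  defines "g \<equiv> implicit_fps (cubic_fps a b c)" and "A \<equiv> 1 + \<bar>a\<bar> + \<bar>b\<bar> + \<bar>c\<bar>"
  shows "\<bar>g $ Suc n\<bar> \<le> A * (A * (27 / 4)) ^ n"
proof -
  have A: "1 \<le> A" "\<bar>a\<bar> \<le> A * 3" "\<bar>b\<bar> \<le> A * 3" "\<bar>c\<bar> \<le> A" by (simp_all add: A_def)
  define h0 where "h0 = implicit_fps ((1 + fps_const A * fps_X) ^ 3)"
  define h where "h = fps_const A * h0"
  have h0_0: "h0 $ 0 = 0" unfolding h0_def by (rule implicit_fps_nth_0)
  then have h_0: "h $ 0 = 0" by (simp add: h_def)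
  have h_Suc: "h $ Suc n = A * (A ^ n * ternary_coeff n)" for n
    by (simp add: h_def h0_def implicit_fps_cube)
  have h_nonneg: "0 \<le> h $ n" for n
    using A ternary_coeff_bounds(1) by (cases n) (simp_all add: h_0 h_Suc)
  have "(1 + fps_const A * fps_X) ^ 3 oo h0 = (1 + h) ^ 3"
    using h0_0 by (simp add: h_def fps_compose_add_distrib fps_compose_mult_distrib fps_compose_power[symmetric])
  moreover have "h0 = fps_X * ((1 + fps_const A * fps_X) ^ 3 oo h0)"
    unfolding h0_def by (rule implicit_fps_eq) (simp add: fps_power_zeroth)
  ultimately have "h0 = fps_X * (1 + h) ^ 3" by metis
  then have "h0 $ Suc n = ((1 + h) ^ 3) $ n" for n by (metis fps_X_mult_nth Suc_neq_Zero diff_Suc_1)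
  moreover have "(1 + h) ^ 3 = 1 + fps_const 3 * h + fps_const 3 * h ^ 2 + h ^ 3"
    by (simp add: power3_eq_cube power2_eq_square algebra_simps numeral_fps_const[symmetric])
  ultimately have h_rec: "h $ Suc n = A * (1 $ n + 3 * h $ n + 3 * (h ^ 2) $ n + (h ^ 3) $ n)" for n
    by (simp add: h_def)
  have g_0: "g $ 0 = 0" unfolding g_def by (rule implicit_fps_nth_0)
  have "g = fps_X * (1 + fps_const a * g + fps_const b * g ^ 2 + fps_const c * g ^ 3)"
    unfolding cubic_fps_compose[OF g_0, symmetric] unfolding g_def by (rule implicit_fps_eq) simp
  then have "g $ Suc n = (1 + fps_const a * g + fps_const b * g ^ 2 + fps_const c * g ^ 3) $ n" for n
    by (metis fps_X_mult_nth Suc_neq_Zero diff_Suc_1)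
  then have g_rec: "g $ Suc n = 1 $ n + a * g $ n + b * (g ^ 2) $ n + c * (g ^ 3) $ n" for n by simp
  have dom: "\<bar>g $ n\<bar> \<le> h $ n" for n
  proof (induction n rule: less_induct)
    case (less m)
    show ?case
    proof (cases m)
      case 0
      then show ?thesis by (simp add: g_0 h_0)
    next
      case (Suc n)
      have 1: "\<bar>g $ k\<bar> \<le> h $ k" if "k \<le> n" for k using less Suc that by simp
      have 2: "\<bar>(g ^ 2) $ k\<bar> \<le> (h ^ 2) $ k" if "k \<le> n" for k
        unfolding power2_eq_square by (rule fps_mult_dominated) (use 1 that in auto)
      have 3: "\<bar>(g ^ 3) $ n\<bar> \<le> (h ^ 3) $ n"
        unfolding power3_eq_cube power2_eq_square[symmetric] by (rule fps_mult_dominated) (use 1 2 in auto)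
      have "\<bar>g $ Suc n\<bar> \<le> \<bar>1 $ n\<bar> + \<bar>a * g $ n\<bar> + \<bar>b * (g ^ 2) $ n\<bar> + \<bar>c * (g ^ 3) $ n\<bar>"
        unfolding g_rec by linarith
      also have "\<dots> \<le> A * 1 $ n + (A * 3) * h $ n + (A * 3) * (h ^ 2) $ n + A * (h ^ 3) $ n"
        unfolding abs_mult using A 1[of n] 2[of n] 3
        by (intro add_mono mult_mono) (auto simp: fps_one_nth)
      also have "\<dots> = h $ Suc n" by (simp add: h_rec algebra_simps)
      finally show ?thesis by (simp add: Suc)
    qed
  qed
  have "\<bar>g $ Suc n\<bar> \<le> A * (A ^ n * ternary_coeff n)" using dom[of "Suc n"] by (simp add: h_Suc)
  also have "\<dots> \<le> A * (A ^ n * (27 / 4) ^ n)"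
    using A ternary_coeff_bounds(2)[of n] by (intro mult_left_mono) auto
  finally show ?thesis by (simp only: power_mult_distrib)
qed

lemma jacobi_extension_bound:
  assumes T: "\<And>n. \<bar>T $ n\<bar> \<le> A * K ^ n" and A: "1 \<le> A" and K: "0 \<le> K"
  shows "\<bar>jacobi_extension 0 1 T $ n\<bar> \<le> (K + A) ^ n"
proof (induction n rule: less_induct)
  case (less m)
  let ?N = "jacobi_extension 0 1 T"
  show ?case
  proof (cases m)
    case 0
    then show ?thesis by (simp add: jacobi_extension_nth)
  next
    case (Suc k)
    have "\<bar>?N $ Suc k\<bar> \<le> (\<Sum>i<k. \<bar>?N $ i * T $ (k - 1 - i)\<bar>)"
      by (simp add: jacobi_extension_nth sum_abs)
    also have "\<dots> \<le> (\<Sum>i<k. (K + A) ^ i * (A * K ^ (k - Suc i)))"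
      unfolding abs_mult using less Suc T[of "k - Suc _"] A K by (intro sum_mono mult_mono) auto
    also have "\<dots> = ((K + A) - K) * (\<Sum>i<k. K ^ (k - Suc i) * (K + A) ^ i)"
      by (simp add: sum_distrib_left mult_ac)
    also have "\<dots> = (K + A) ^ k - K ^ k" by (rule power_diff_sumr2[symmetric])
    also have "\<dots> \<le> (K + A) ^ Suc k"
    proof -
      have "(K + A) ^ k \<le> (K + A) ^ Suc k" using A K by (intro power_increasing) auto
      then show ?thesis using zero_le_power[OF K, of k] by linarith
    qed
    finally show ?thesis by (simp add: Suc)
  qed
qed

section \<open>Construction of the generating measure\<close>

lemma fps_conv_radius_pos_if_geometric:
  fixes f :: "real fps"
  assumes "\<And>n. \<bar>f $ n\<bar> \<le> A * K ^ n" "0 < K"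
  shows "0 < fps_conv_radius f"
proof -
  let ?r = "1 / (2 * K)"
  have "summable (\<lambda>n. f $ n * ?r ^ n)"
  proof (rule summable_comparison_test')
    show "summable (\<lambda>n. A * (1 / 2 :: real) ^ n)" by (intro summable_mult summable_geometric) simp
    show "norm (f $ n * ?r ^ n) \<le> A * (1 / 2) ^ n" for n
    proof -
      have "norm (f $ n * ?r ^ n) = \<bar>f $ n\<bar> * ?r ^ n" using assms(2) by (simp add: abs_mult)
      also have "\<dots> \<le> (A * K ^ n) * ?r ^ n" using assms by (intro mult_right_mono) auto
      also have "\<dots> = A * (1 / 2) ^ n" using assms(2) by (simp add: power_divide power_mult_distrib)
      finally show ?thesis .
    qed
  qed
  then have "norm ?r \<le> fps_conv_radius f" unfolding fps_conv_radius_def by (rule conv_radius_geI)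
  moreover have "0 < ereal (norm ?r)" using assms(2) by simp
  ultimately show ?thesis by (rule less_le_trans[rotated])
qed

lemma cauchy_transform_expansion:
  assumes M: "real_distribution M" "AE x in M. \<bar>x\<bar> \<le> R" and R: "0 < R"
    and moments: "\<And>n. (LINT x|M. x ^ n) = N $ n"
  shows "(\<lambda>w. LINT x|M. 1 / (1 - w * x)) has_fps_expansion N"
proof -
  interpret real_distribution M by fact
  have int: "integrable M (\<lambda>x. x ^ n)" for n by (rule integrable_power_bounded[OF M])
  have absint: "(LINT x|M. \<bar>x\<bar> ^ n) \<le> R ^ n" for n
  proof -
    have "(LINT x|M. \<bar>x\<bar> ^ n) \<le> (LINT x|M. R ^ n)"
    proof (rule integral_mono_AE)
      show "integrable M (\<lambda>x. \<bar>x\<bar> ^ n)" using integrable_abs[OF int[of n]] by (simp add: power_abs)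
      show "AE x in M. \<bar>x\<bar> ^ n \<le> R ^ n" using M(2) by (rule eventually_mono) (simp add: power_mono)
    qed simp
    then show ?thesis using prob_space by simp
  qed
  have bound: "\<bar>N $ n\<bar> \<le> 1 * R ^ n" for n
  proof -
    have "\<bar>N $ n\<bar> \<le> (LINT x|M. \<bar>x ^ n\<bar>)" unfolding moments[symmetric] by (rule integral_abs_bound)
    with absint[of n] show ?thesis by (simp add: power_abs)
  qed
  have "eval_fps N w = (LINT x|M. 1 / (1 - w * x))" if w: "\<bar>w\<bar> < 1 / R" for w
  proof -
    have wR: "\<bar>w\<bar> * R < 1" using w R by (simp add: field_simps)
    have le: "AE x in M. \<bar>w * x\<bar> \<le> \<bar>w\<bar> * R"
      using M(2) by (rule eventually_mono) (simp add: abs_mult mult_left_mono)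
    have "(\<lambda>n. LINT x|M. (w * x) ^ n) sums (LINT x|M. (\<Sum>n. (w * x) ^ n))"
    proof (rule sums_integral)
      show "integrable M (\<lambda>x. (w * x) ^ n)" for n using int[of n] by (simp add: power_mult_distrib)
      show "AE x in M. summable (\<lambda>n. norm ((w * x) ^ n))"
        using le by (rule eventually_mono) (use wR in \<open>auto simp: power_abs intro!: summable_geometric\<close>)
      show "summable (\<lambda>n. LINT x|M. norm ((w * x) ^ n))"
      proof (rule summable_comparison_test')
        show "summable (\<lambda>n. (\<bar>w\<bar> * R) ^ n)" using wR R by (intro summable_geometric) (simp add: abs_mult)
        show "norm (LINT x|M. norm ((w * x) ^ n)) \<le> (\<bar>w\<bar> * R) ^ n" for n
          using mult_left_mono[OF absint[of n], of "\<bar>w\<bar> ^ n"]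
          by (simp add: power_abs power_mult_distrib abs_mult)
      qed
    qed
    moreover have "(LINT x|M. (\<Sum>n. (w * x) ^ n)) = (LINT x|M. 1 / (1 - w * x))"
    proof (rule integral_cong_AE)
      show "AE x in M. (\<Sum>n. (w * x) ^ n) = 1 / (1 - w * x)"
        using le by (rule eventually_mono) (use wR in \<open>auto intro!: suminf_geometric\<close>)
    qed auto
    moreover have "(LINT x|M. (w * x) ^ n) = N $ n * w ^ n" for n
      using moments[of n] by (simp add: power_mult_distrib)
    ultimately show ?thesis by (simp add: eval_fps_def sums_iff)
  qed
  moreover have "eventually (\<lambda>w. \<bar>w\<bar> < 1 / R) (nhds (0::real))"
    by (rule eventually_nhds_in_open[of "{w. \<bar>w\<bar> < 1 / R}", simplified]) 
       (use R in \<open>auto intro!: open_Collect_less continuous_intros\<close>)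
  ultimately show ?thesis
    unfolding has_fps_expansion_def using fps_conv_radius_pos_if_geometric[OF bound R]
    by (auto elim!: eventually_mono)
qed

lemma has_fps_expansion_unique_near_0:
  assumes "f has_fps_expansion F" "g has_fps_expansion F"
  shows "eventually (\<lambda>z. f z = g z) (nhds 0)"
proof -
  have "eventually (\<lambda>z. eval_fps F z = f z) (nhds 0)" "eventually (\<lambda>z. eval_fps F z = g z) (nhds 0)"
    using assms by (auto simp: has_fps_expansion_def)
  then show ?thesis by eventually_elim simp
qed

lemma csk_prob_if_integral:
  assumes nu: "real_distribution \<nu>" and ae: "AE x in \<nu>. 0 < 1 - w * x \<and> 1 / (1 - w * x) \<le> K"
    and int: "(LINT x|\<nu>. 1 / (1 - w * x)) * V m = V m + m\<^sup>2" 
    and pos: "0 < V m" "m \<noteq> 0" and w: "w * (V m + m\<^sup>2) = m"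
  shows "csk_prob \<nu> V m"
proof -
  interpret real_distribution \<nu> by fact
  let ?P = "V m + m\<^sup>2"
  have P: "0 < ?P" using pos by (simp add: add_pos_nonneg)
  have eq: "csk_density V x m = V m / ?P * (1 / (1 - w * x))" for x
  proof -
    have "V m + m * (m - x) = ?P - m * x" by (simp add: algebra_simps power2_eq_square)
    also have "\<dots> = ?P * (1 - w * x)" by (subst (3) w[symmetric]) (simp add: algebra_simps)
    finally show ?thesis using pos by (simp add: csk_density_def)
  qed
  have nonneg: "AE x in \<nu>. 0 \<le> csk_density V x m"
    using ae by (rule eventually_mono) (use pos P in \<open>simp add: eq\<close>)
  have [measurable]: "(\<lambda>x. csk_density V x m) \<in> borel_measurable \<nu>" unfolding eq by measurable
  have integrable: "integrable \<nu> (\<lambda>x. 1 / (1 - w * x))"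
  proof (rule integrable_const_bound[where B = K])
    show "AE x in \<nu>. norm (1 / (1 - w * x)) \<le> K" using ae by (rule eventually_mono) simp
  qed measurable
  have one: "(LINT x|\<nu>. csk_density V x m) = 1"
    unfolding eq integral_mult_right_zero using int pos P by (simp add: field_simps)
  have "emeasure (density \<nu> (\<lambda>x. ennreal (csk_density V x m))) (space \<nu>) = (\<integral>\<^sup>+x. ennreal (csk_density V x m) \<partial>\<nu>)"
    by (subst emeasure_density) (auto intro!: nn_integral_cong)
  also have "\<dots> = ennreal (LINT x|\<nu>. csk_density V x m)"
  proof (rule nn_integral_eq_integral[OF _ nonneg])
    show "integrable \<nu> (\<lambda>x. csk_density V x m)"
      unfolding eq using integrable by (rule integrable_mult_right)
  qed
  finally have "prob_space (density \<nu> (\<lambda>x. ennreal (csk_density V x m)))"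
    by (intro prob_spaceI) (simp add: one)
  with nonneg show ?thesis by (simp add: csk_prob_def)
qed

text \<open>The right-hand side is a contraction on \<open>{-1..1}\<close> when \<open>w\<close> is small. This identifies the value of the inverse
  series at \<open>m / P(m)\<close> with \<open>m\<close>.\<close>

lemma root_of_implicit_cubic_unique:
  fixes y m w :: real
  assumes "y = w * (1 + a * y + b * y\<^sup>2 + c * y ^ 3)" "m = w * (1 + a * m + b * m\<^sup>2 + c * m ^ 3)"
    and "\<bar>y\<bar> \<le> 1" "\<bar>m\<bar> \<le> 1" and small: "\<bar>w\<bar> * (\<bar>a\<bar> + 2 * \<bar>b\<bar> + 3 * \<bar>c\<bar>) < 1"
  shows "y = m"
proof (rule ccontr)
  assume ne: "y \<noteq> m"
  let ?q = "a + b * (y + m) + c * (y\<^sup>2 + y * m + m\<^sup>2)"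
  have "y - m = w * (1 + a * y + b * y\<^sup>2 + c * y ^ 3) - w * (1 + a * m + b * m\<^sup>2 + c * m ^ 3)"
    using assms(1,2) by simp
  also have "\<dots> = (w * ?q) * (y - m)" by (simp add: algebra_simps power2_eq_square power3_eq_cube)
  finally have q: "w * ?q = 1" using ne by simp
  have sq: "y\<^sup>2 \<le> 1" "m\<^sup>2 \<le> 1" using assms(3,4) by (simp_all add: abs_square_le_1)
  have "\<bar>y * m\<bar> \<le> 1 * 1" unfolding abs_mult using assms(3,4) by (intro mult_mono) auto
  then have "\<bar>y\<^sup>2 + y * m + m\<^sup>2\<bar> \<le> 3" using sq zero_le_power2[of y] zero_le_power2[of m] by linarith
  then have "\<bar>c * (y\<^sup>2 + y * m + m\<^sup>2)\<bar> \<le> \<bar>c\<bar> * 3" unfolding abs_mult by (intro mult_left_mono) auto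
  moreover have "\<bar>b * (y + m)\<bar> \<le> \<bar>b\<bar> * 2" unfolding abs_mult using assms(3,4) by (intro mult_left_mono) auto
  ultimately have "\<bar>?q\<bar> \<le> \<bar>a\<bar> + 2 * \<bar>b\<bar> + 3 * \<bar>c\<bar>" by linarith
  then have "\<bar>w\<bar> * \<bar>?q\<bar> \<le> \<bar>w\<bar> * (\<bar>a\<bar> + 2 * \<bar>b\<bar> + 3 * \<bar>c\<bar>)" by (rule mult_left_mono) simp
  with small have "\<bar>w * ?q\<bar> < 1" by (simp add: abs_mult)
  with q show False by simp
qed

lemma tendsto_nhds_if_isCont: "isCont f a \<Longrightarrow> (f \<longlongrightarrow> f a) (nhds a)"
  by (simp add: isCont_def tendsto_at_iff_tendsto_nhds)

lemma eventually_nhds_imp_interval: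
  fixes P :: "real \<Rightarrow> bool"
  assumes "eventually P (nhds 0)"
  shows "\<exists>d>0. \<forall>x\<in>{-d<..<d}. P x"
proof -
  obtain d where "0 < d" "\<forall>x. dist x 0 < d \<longrightarrow> P x" using assms unfolding eventually_nhds_metric by blast
  then show ?thesis by (intro exI[of _ d]) auto
qed

lemma cubic_has_fps_expansion:
  "(\<lambda>m::real. 1 + a * m + b * m^2 + c * m^3) has_fps_expansion
    1 + fps_const a * fps_X + fps_const b * fps_X ^ 2 + fps_const c * fps_X ^ 3"
  by (intro fps_expansion_intros)

text \<open>All identities between power series turn into identities between functions near 0, because the series
  converge. The measure itself comes from the solution of the moment problem for
  \<open>N = 1 / (1 - X g)\<close>.\<close>

theorem cubic_in_variance_class:
  fixes a b c :: real
  assumes "27 * c\<^sup>2 \<le> (b + 1) ^ 3"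
  shows "(\<lambda>m. 1 + a * m + b * m^2 + c * m^3) \<in> variance_class"
proof -
  define V where "V = (\<lambda>m. 1 + a * m + b * m^2 + c * m^3)"
  define g where "g = implicit_fps (cubic_fps a (b + 1) c)"
  define T where "T = fps_shift 1 g"
  define N where "N = jacobi_extension 0 1 T"
  define A where "A = 1 + \<bar>a\<bar> + \<bar>b + 1\<bar> + \<bar>c\<bar>"
  define K where "K = A * (27 / 4)"
  define R where "R = K + A"
  have A: "1 \<le> A" by (simp add: A_def)
  then have K: "1 \<le> K" by (simp add: K_def)
  have R: "0 < R" using A K by (simp add: R_def)
  have g0: "g $ 0 = 0" unfolding g_def by (rule implicit_fps_nth_0)
  have g_Suc: "\<bar>g $ Suc n\<bar> \<le> A * K ^ n" for n
    unfolding g_def A_def K_def by (rule implicit_cubic_bound)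
  have g_bound: "\<bar>g $ n\<bar> \<le> A * K ^ n" for n
  proof (cases n)
    case (Suc k)
    have "A * K ^ k \<le> A * K ^ Suc k" using A K by (intro mult_left_mono power_increasing) auto
    with g_Suc[of k] Suc show ?thesis by simp
  qed (use g0 A in simp)
  have T_pos: "positive_moments (fps_nth T)"
    unfolding T_def g_def by (rule positive_moments_cubic[OF assms])
  have N_pos: "positive_moments (fps_nth N)"
    unfolding N_def by (rule positive_moments_jacobi_extension[OF T_pos]) simp
  have N_bound: "\<bar>N $ n\<bar> \<le> 1 * R ^ n" for n
    using jacobi_extension_bound[of T A K n] g_Suc A K by (simp add: T_def N_def R_def)
  have N0: "N $ 0 = 1" by (simp add: N_def jacobi_extension_nth)
  obtain \<nu> where nu: "real_distribution \<nu>" "AE x in \<nu>. \<bar>x\<bar> \<le> R" "\<And>n. (LINT x|\<nu>. x ^ n) = N $ n"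
    using bounded_hamburger[OF N_pos N0 R N_bound] by blast
  interpret real_distribution \<nu> by (rule nu)
  have g_eq: "g = fps_X * (1 + fps_const a * g + fps_const (b + 1) * (g * g) + fps_const c * (g * (g * g)))"
    using implicit_fps_eq[of "cubic_fps a (b + 1) c"] g0
    by (simp add: cubic_fps_compose power2_eq_square power3_eq_cube mult.assoc flip: g_def)
  have XT: "fps_X * T = g"
  proof (rule fps_ext)
    fix n show "(fps_X * T) $ n = g $ n" using g0 by (cases n) (simp_all add: T_def)
  qed
  have N_eq: "N * (1 - fps_X * g) = 1"
  proof -
    have "N = inverse (1 - fps_X * g)"
      unfolding N_def jacobi_extension_def XT[symmetric] by (simp add: power2_eq_square mult.assoc)
    then show ?thesis by (simp add: inverse_mult_eq_1)
  qed
  have mean: "(LINT x|\<nu>. x) = 0"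
    using nu(3)[of 1] by (simp add: N_def jacobi_extension_nth)
  have second: "(LINT x|\<nu>. x\<^sup>2) = 1"
  proof -
    have "g $ Suc 0 = (1 + fps_const a * g + fps_const (b + 1) * (g * g) + fps_const c * (g * (g * g))) $ 0"
      by (subst g_eq) simp
    then have "T $ 0 = 1" by (simp add: T_def g0)
    then show ?thesis using nu(3)[of 2] by (simp add: N_def numeral_2_eq_2 jacobi_extension_nth)
  qed
  define E where "E = (\<lambda>w. LINT x|\<nu>. 1 / (1 - w * x))"
  define y where "y = eval_fps g"
  have E: "E has_fps_expansion N"
    unfolding E_def by (rule cauchy_transform_expansion[OF nu(1,2) R nu(3)])
  have y: "y has_fps_expansion g"
    unfolding y_def
    by (rule eval_fps_has_fps_expansion, rule fps_conv_radius_pos_if_geometric[OF g_bound]) (use K in simp)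
  have "(\<lambda>w. w * (1 + a * y w + (b + 1) * (y w * y w) + c * (y w * (y w * y w)))) has_fps_expansion
      fps_X * (1 + fps_const a * g + fps_const (b + 1) * (g * g) + fps_const c * (g * (g * g)))"
    by (intro fps_expansion_intros y)
  then have "(\<lambda>w. w * (1 + a * y w + (b + 1) * (y w * y w) + c * (y w * (y w * y w)))) has_fps_expansion g"
    by (simp flip: g_eq)
  from has_fps_expansion_unique_near_0[OF y this]
  have ev1: "eventually (\<lambda>w. y w = w * (1 + a * y w + (b + 1) * (y w)\<^sup>2 + c * (y w) ^ 3)) (nhds 0)"
    by (simp add: power2_eq_square power3_eq_cube mult.assoc)
  have "(\<lambda>w. E w * (1 - w * y w)) has_fps_expansion N * (1 - fps_X * g)"
    by (intro fps_expansion_intros E y)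
  then have "(\<lambda>w. E w * (1 - w * y w)) has_fps_expansion 1" by (simp add: N_eq)
  then have ev2: "eventually (\<lambda>w. E w * (1 - w * y w) = 1) (nhds 0)"
    by (rule has_fps_expansion_unique_near_0) simp
  have "(y \<longlongrightarrow> y 0) (nhds 0)"
    by (rule tendsto_nhds_if_isCont) (rule has_fps_expansion_imp_continuous[OF y])
  moreover have "y 0 = 0" by (simp add: y_def eval_fps_at_0 g0)
  ultimately have "((\<lambda>w. \<bar>y w\<bar>) \<longlongrightarrow> 0) (nhds 0)" by (simp add: tendsto_rabs_zero)
  then have ev3: "eventually (\<lambda>w. \<bar>y w\<bar> < 1) (nhds 0)" by (rule order_tendstoD) simp
  have lim: "((\<lambda>w. \<bar>w\<bar> * C) \<longlongrightarrow> 0) (nhds (0::real))" for C :: real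
    using tendsto_nhds_if_isCont[of 0 "\<lambda>w. \<bar>w\<bar> * C"] by simp
  have ev4: "eventually (\<lambda>w. \<bar>w\<bar> * (\<bar>a\<bar> + 2 * \<bar>b + 1\<bar> + 3 * \<bar>c\<bar>) < 1) (nhds 0)"
    and ev5: "eventually (\<lambda>w. \<bar>w\<bar> * R < 1 / 2) (nhds 0)"
    by (rule order_tendstoD(2)[OF lim], simp)+
  define \<phi> where "\<phi> = (\<lambda>m. m / (V m + m\<^sup>2))"
  have Vlim: "(V \<longlongrightarrow> 1) (nhds 0)" 
    using tendsto_nhds_if_isCont[of 0 V] by (simp add: V_def)
  have "(\<phi> \<longlongrightarrow> 0) (nhds 0)" 
    using tendsto_nhds_if_isCont[of 0 \<phi>] by (simp add: \<phi>_def V_def)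
  then have \<phi>: "filterlim \<phi> (nhds 0) (nhds 0)" .
  have evV: "eventually (\<lambda>m. 0 < V m) (nhds 0)" using order_tendstoD(1)[OF Vlim, of 0] by simp
  have evm: "eventually (\<lambda>m::real. \<bar>m\<bar> < 1) (nhds 0)" using order_tendstoD(2)[OF lim[of 1], of 1] by simp
  have "eventually (\<lambda>m. csk_prob \<nu> V m) (nhds 0)"
    using eventually_compose_filterlim[OF ev1 \<phi>] eventually_compose_filterlim[OF ev2 \<phi>]
      eventually_compose_filterlim[OF ev3 \<phi>] eventually_compose_filterlim[OF ev4 \<phi>]
      eventually_compose_filterlim[OF ev5 \<phi>] evV evm
  proof eventually_elim
    case (elim m)
    let ?w = "\<phi> m"
    show ?case
    proof (cases "m = 0")
      case True
      have "density \<nu> (\<lambda>x. ennreal 1) = \<nu>" by (simp add: density_1)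
      then show ?thesis using True prob_space_axioms by (simp add: csk_prob_def csk_density_def)
    next
      case False
      have P: "0 < V m + m\<^sup>2" using elim by (simp add: add_pos_nonneg)
      have w: "?w * (V m + m\<^sup>2) = m" using P by (simp add: \<phi>_def)
      have "V m + m\<^sup>2 = 1 + a * m + (b + 1) * m\<^sup>2 + c * m ^ 3" by (simp add: V_def algebra_simps)
      with w have m: "m = ?w * (1 + a * m + (b + 1) * m\<^sup>2 + c * m ^ 3)" by simp
      have "y ?w = m"
        by (rule root_of_implicit_cubic_unique[OF elim(1) m _ _ elim(4)]) (use elim in simp_all)
      with elim have "E ?w * (1 - ?w * m) = 1" by simp
      moreover have "V m = (1 - ?w * m) * (V m + m\<^sup>2)"
      proof -
        have "(1 - ?w * m) * (V m + m\<^sup>2) = (V m + m\<^sup>2) - m * (?w * (V m + m\<^sup>2))"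
          by (simp add: algebra_simps)
        then show ?thesis unfolding w by (simp add: power2_eq_square)
      qed
      then have "E ?w * V m = (E ?w * (1 - ?w * m)) * (V m + m\<^sup>2)" by (simp only: mult.assoc)
      ultimately have "E ?w * V m = V m + m\<^sup>2" by simp
      moreover have "AE x in \<nu>. 0 < 1 - ?w * x \<and> 1 / (1 - ?w * x) \<le> 2"
        using nu(2)
      proof (rule eventually_mono)
        fix x assume "\<bar>x\<bar> \<le> R"
        then have "\<bar>?w * x\<bar> \<le> \<bar>?w\<bar> * R" unfolding abs_mult by (rule mult_left_mono) simp
        with elim(5) have "1 / 2 \<le> 1 - ?w * x" by linarith
        then show "0 < 1 - ?w * x \<and> 1 / (1 - ?w * x) \<le> 2" by (auto simp: field_simps)
      qed
      ultimately show ?thesis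
        by (intro csk_prob_if_integral[OF nu(1), where w = ?w and K = 2]) (use elim False w in \<open>simp_all add: E_def\<close>)
    qed
  qed
  then obtain d where d: "0 < d" "\<forall>m\<in>{-d<..<d}. csk_prob \<nu> V m" using eventually_nhds_imp_interval by blast
  have "csk_generator \<nu>"
    unfolding csk_generator_def
  proof (intro conjI)
    show "compactly_supported \<nu>"
      unfolding compactly_supported_def
    proof (intro exI conjI)
      show "AE x in \<nu>. x \<in> {-R..R}" using nu(2) by (rule eventually_mono) (simp add: abs_le_iff)
    qed simp
    show "\<not> (\<exists>x0. AE x in \<nu>. x = x0)"
    proof
      assume "\<exists>x0. AE x in \<nu>. x = x0"
      then obtain x0 where x0: "AE x in \<nu>. x = x0" ..
      have "(LINT x|\<nu>. x ^ n) = (LINT x|\<nu>. x0 ^ n)" for n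
        by (rule integral_cong_AE) (use x0 in \<open>auto elim!: eventually_mono\<close>)
      then have "(LINT x|\<nu>. x ^ n) = x0 ^ n" for n using prob_space by simp
      from this[of 1] this[of 2] show False using mean second by simp
    qed
  qed (auto simp: mean prob_space_axioms)
  moreover have "\<exists>F. V has_fps_expansion F" unfolding V_def using cubic_has_fps_expansion by blast
  moreover have "\<exists>m1 m2. m1 < 0 \<and> 0 < m2 \<and> (\<forall>m\<in>{m1<..<m2}. csk_prob \<nu> V m)"
    using d by (intro exI[of _ "-d"] exI[of _ d]) simp
  ultimately have "is_variance_function \<nu> V" by (simp add: is_variance_function_def V_def)
  then show ?thesis using second unfolding variance_class_def V_def by blast
qed

section \<open>The complex moment generating function\<close>

definition moment_gf :: "real measure \<Rightarrow> complex \<Rightarrow> complex" where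
  "moment_gf M w = (LINT x|M. 1 / (1 - w * complex_of_real x))"

context
  fixes M :: "real measure" and R :: real
  assumes M: "real_distribution M" and supp: "AE x in M. \<bar>x\<bar> \<le> R" and R: "0 < R"
begin

lemma moment_gf_denominator_bounded_below:
  assumes "\<And>x. \<bar>x\<bar> \<le> R \<Longrightarrow> 1 - w * complex_of_real x \<noteq> 0"
  obtains \<delta> where "0 < \<delta>" "\<And>x. \<bar>x\<bar> \<le> R \<Longrightarrow> \<delta> \<le> cmod (1 - w * complex_of_real x)"
proof -
  have "\<exists>x\<in>{-R..R}. \<forall>y\<in>{-R..R}. cmod (1 - w * complex_of_real x) \<le> cmod (1 - w * complex_of_real y)"
    by (rule continuous_attains_inf) (use R in \<open>auto intro!: continuous_intros\<close>)
  then obtain x where x: "x \<in> {-R..R}"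
      "\<And>y. y \<in> {-R..R} \<Longrightarrow> cmod (1 - w * complex_of_real x) \<le> cmod (1 - w * complex_of_real y)"
    by blast
  show ?thesis
  proof (rule that)
    show "0 < cmod (1 - w * complex_of_real x)" using assms[of x] x(1) by (auto simp: abs_le_iff)
    show "cmod (1 - w * complex_of_real x) \<le> cmod (1 - w * complex_of_real y)" if "\<bar>y\<bar> \<le> R" for y
      using x(2)[of y] that by (auto simp: abs_le_iff)
  qed
qed

lemma moment_gf_integrable:
  assumes "f \<in> borel_measurable borel" "\<And>x. \<bar>x\<bar> \<le> R \<Longrightarrow> cmod (f x) \<le> B"
  shows "integrable M f"
proof -
  interpret real_distribution M by (rule M)
  show ?thesis
  proof (rule integrable_const_bound[where B = B])
    show "AE x in M. cmod (f x) \<le> B" using supp by (rule eventually_mono) (rule assms(2))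
    show "f \<in> borel_measurable M" using assms(1) by (simp cong: measurable_cong_sets)
  qed
qed

lemma moment_gf_integral_bound:
  assumes "f \<in> borel_measurable borel" "\<And>x. \<bar>x\<bar> \<le> R \<Longrightarrow> cmod (f x) \<le> B"
  shows "cmod (LINT x|M. f x) \<le> B"
proof -
  interpret real_distribution M by (rule M)
  have "cmod (LINT x|M. f x) \<le> (LINT x|M. cmod (f x))" by (rule integral_norm_bound)
  also have "\<dots> \<le> (LINT x|M. B)"
  proof (rule integral_mono_AE)
    show "integrable M (\<lambda>x. cmod (f x))" using moment_gf_integrable[OF assms] by (rule integrable_norm)
    show "AE x in M. cmod (f x) \<le> B" using supp by (rule eventually_mono) (rule assms(2))
  qed simp
  also have "\<dots> = B" using prob_space by simp
  finally show ?thesis .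
qed

text \<open>The difference quotient of the integrand differs from its derivative by
  \<open>(v - w) x\<^sup>2 / ((1 - w x)\<^sup>2 (1 - v x))\<close>, which is \<open>O(v - w)\<close> uniformly on the support.\<close>

lemma moment_gf_field_differentiable:
  assumes ne: "\<And>x. \<bar>x\<bar> \<le> R \<Longrightarrow> 1 - w * complex_of_real x \<noteq> 0"
  shows "moment_gf M field_differentiable at w"
proof -
  obtain \<delta> where \<delta>: "0 < \<delta>" "\<And>x. \<bar>x\<bar> \<le> R \<Longrightarrow> \<delta> \<le> cmod (1 - w * complex_of_real x)"
    using moment_gf_denominator_bounded_below[OF ne] by blast
  let ?q = "\<lambda>v x. 1 - v * complex_of_real x"
  define D where "D = (LINT x|M. of_real x / (?q w x)\<^sup>2)"
  define C where "C = R\<^sup>2 / (\<delta>\<^sup>2 * (\<delta> / 2))"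
  have near: "cmod ((moment_gf M v - moment_gf M w) / (v - w) - D) \<le> C * cmod (v - w)"
    if v: "cmod (v - w) < \<delta> / (2 * R)" "v \<noteq> w" for v
  proof -
    have qv: "\<delta> / 2 \<le> cmod (?q v x)" if x: "\<bar>x\<bar> \<le> R" for x
    proof -
      have "cmod ((v - w) * complex_of_real x) \<le> \<delta> / (2 * R) * R"
        unfolding norm_mult using v x R \<delta>(1) by (intro mult_mono) auto
      also have "\<dots> = \<delta> / 2" using R by simp
      finally have "cmod ((v - w) * complex_of_real x) \<le> \<delta> / 2" .
      moreover have "cmod (?q w x) \<le> cmod (?q v x) + cmod ((v - w) * complex_of_real x)"
        using norm_triangle_ineq[of "?q v x" "(v - w) * complex_of_real x"] by (simp add: algebra_simps)
      ultimately show ?thesis using \<delta>(2)[OF x] by linarith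
    qed
    have int_v: "integrable M (\<lambda>x. 1 / ?q v x)"
    proof (rule moment_gf_integrable[where B = "1 / (\<delta> / 2)"])
      show "cmod (1 / ?q v x) \<le> 1 / (\<delta> / 2)" if "\<bar>x\<bar> \<le> R" for x
        unfolding norm_divide norm_one using qv[OF that] \<delta>(1) by (intro frac_le) auto
    qed measurable
    have int_w: "integrable M (\<lambda>x. 1 / ?q w x)"
    proof (rule moment_gf_integrable[where B = "1 / \<delta>"])
      show "cmod (1 / ?q w x) \<le> 1 / \<delta>" if "\<bar>x\<bar> \<le> R" for x
        unfolding norm_divide norm_one using \<delta>(2)[OF that] \<delta>(1) by (intro frac_le) auto
    qed measurable
    have int_D: "integrable M (\<lambda>x. of_real x / (?q w x)\<^sup>2)"
      by (rule moment_gf_integrable[where B = "R / \<delta>\<^sup>2"])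
         (use \<delta> R in \<open>auto simp: norm_divide norm_power intro!: frac_le power_mono\<close>)
    have "(moment_gf M v - moment_gf M w) / (v - w) - D =
        (LINT x|M. (1 / ?q v x - 1 / ?q w x) / (v - w) - of_real x / (?q w x)\<^sup>2)"
      unfolding moment_gf_def D_def using int_v int_w int_D by simp
    also have "\<dots> = (LINT x|M. (v - w) * ((of_real x)\<^sup>2 / ((?q w x)\<^sup>2 * ?q v x)))"
    proof (rule integral_cong_AE)
      show "AE x in M. (1 / ?q v x - 1 / ?q w x) / (v - w) - of_real x / (?q w x)\<^sup>2 =
          (v - w) * ((of_real x)\<^sup>2 / ((?q w x)\<^sup>2 * ?q v x))"
        using supp
      proof (rule eventually_mono)
        fix x assume x: "\<bar>x\<bar> \<le> R"
        have nz: "?q v x \<noteq> 0" "?q w x \<noteq> 0" using qv[OF x] \<delta>(1) ne[OF x] by auto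
        have "1 / ?q v x - 1 / ?q w x = (v - w) * of_real x / (?q v x * ?q w x)"
          using nz by (simp add: field_simps)
        then have "(1 / ?q v x - 1 / ?q w x) / (v - w) = of_real x / (?q v x * ?q w x)" using v by simp
        moreover have "of_real x / (?q v x * ?q w x) - of_real x / (?q w x)\<^sup>2 =
            of_real x * (?q w x - ?q v x) / ((?q w x)\<^sup>2 * ?q v x)"
          using nz by (simp add: divide_simps power2_eq_square) (simp add: algebra_simps)
        moreover have "?q w x - ?q v x = (v - w) * of_real x" by (simp add: algebra_simps)
        ultimately show "(1 / ?q v x - 1 / ?q w x) / (v - w) - of_real x / (?q w x)\<^sup>2 =
            (v - w) * ((of_real x)\<^sup>2 / ((?q w x)\<^sup>2 * ?q v x))"
          by (simp add: power2_eq_square)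
      qed
    qed (use M in \<open>auto simp: real_distribution_def real_distribution_axioms_def cong: measurable_cong_sets\<close>)
    also have "cmod \<dots> \<le> cmod (v - w) * C"
    proof (rule moment_gf_integral_bound)
      fix x :: real assume x: "\<bar>x\<bar> \<le> R"
      have "cmod ((of_real x)\<^sup>2 / ((?q w x)\<^sup>2 * ?q v x)) = \<bar>x\<bar>\<^sup>2 / (cmod (?q w x) ^ 2 * cmod (?q v x))"
        by (simp add: norm_divide norm_mult norm_power)
      also have "\<dots> \<le> C"
        unfolding C_def using \<delta>(1) \<delta>(2)[OF x] qv[OF x] x R
        by (intro frac_le mult_mono power_mono mult_pos_pos) auto
      finally show "cmod ((v - w) * ((of_real x)\<^sup>2 / ((?q w x)\<^sup>2 * ?q v x))) \<le> cmod (v - w) * C"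
        by (simp only: norm_mult mult_left_mono norm_ge_zero)
    qed measurable
    finally show ?thesis by (simp add: mult.commute)
  qed
  have "((\<lambda>v. (moment_gf M v - moment_gf M w) / (v - w) - D) \<longlongrightarrow> 0) (at w)"
  proof (rule Lim_null_comparison)
    show "eventually (\<lambda>v. cmod ((moment_gf M v - moment_gf M w) / (v - w) - D) \<le> C * cmod (v - w)) (at w)"
      unfolding eventually_at using near \<delta>(1) R
      by (intro exI[of _ "\<delta> / (2 * R)"]) (auto simp: dist_norm)
    have "((\<lambda>v. C * cmod (v - w)) \<longlongrightarrow> C * cmod (w - w)) (at w)" by (intro tendsto_intros)
    then show "((\<lambda>v. C * cmod (v - w)) \<longlongrightarrow> 0) (at w)" by simp
  qed
  then have "((\<lambda>v. (moment_gf M v - moment_gf M w) / (v - w)) \<longlongrightarrow> D) (at w)" by (rule LIM_zero_cancel)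
  then show ?thesis unfolding field_differentiable_def has_field_derivative_iff by blast
qed

text \<open>For a centred measure \<open>1 + w x\<close> integrates to 1, and the remainder of the geometric series is
  \<open>(w x)\<^sup>2 / (1 - w x)\<close>.\<close>

lemma moment_gf_centered_bound:
  assumes mean: "(LINT x|M. x) = 0" and w: "cmod w * R \<le> 1 / 2"
  shows "cmod (moment_gf M w - 1) \<le> 2 * R\<^sup>2 * (cmod w)\<^sup>2"
proof -
  interpret real_distribution M by (rule M)
  have q: "1 / 2 \<le> cmod (1 - w * complex_of_real x)" if x: "\<bar>x\<bar> \<le> R" for x
  proof -
    have "cmod (w * complex_of_real x) \<le> cmod w * R" using x by (simp add: norm_mult mult_left_mono)
    then show ?thesis using w norm_triangle_ineq2[of 1 "w * complex_of_real x"] by simp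
  qed
  have int: "integrable M (\<lambda>x. 1 / (1 - w * complex_of_real x))"
  proof (rule moment_gf_integrable[where B = 2])
    show "cmod (1 / (1 - w * complex_of_real x)) \<le> 2" if "\<bar>x\<bar> \<le> R" for x
      using frac_le[of 1 1 "1 / 2" "cmod (1 - w * complex_of_real x)"] q[OF that] by (simp add: norm_divide)
  qed measurable
  have intx: "integrable M (\<lambda>x. complex_of_real x)"
    by (rule moment_gf_integrable[where B = R]) auto
  have "(LINT x|M. complex_of_real x) = 0" using mean by (simp add: integral_complex_of_real)
  then have "moment_gf M w - 1 = (LINT x|M. 1 / (1 - w * complex_of_real x) - 1 - w * complex_of_real x)"
    unfolding moment_gf_def using int intx prob_space by simp
  also have "cmod \<dots> \<le> 2 * R\<^sup>2 * (cmod w)\<^sup>2"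
  proof (rule moment_gf_integral_bound)
    fix x :: real assume x: "\<bar>x\<bar> \<le> R"
    have nz: "1 - w * complex_of_real x \<noteq> 0" using q[OF x] by auto
    then have "1 / (1 - w * complex_of_real x) - 1 - w * complex_of_real x = (w * of_real x)\<^sup>2 / (1 - w * complex_of_real x)"
      by (simp add: divide_simps power2_eq_square) (simp add: algebra_simps)
    also have "cmod \<dots> \<le> (cmod w * R)\<^sup>2 / (1 / 2)"
      unfolding norm_divide norm_power norm_mult using q[OF x] x by (intro frac_le power_mono mult_left_mono) auto
    finally show "cmod (1 / (1 - w * complex_of_real x) - 1 - w * complex_of_real x) \<le> 2 * R\<^sup>2 * (cmod w)\<^sup>2"
      by (simp add: power_mult_distrib mult_ac)
  qed measurable
  finally show ?thesis .
qed

end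

section \<open>Necessity of the cubic condition\<close>

text \<open>With \<open>B = 3 \<kappa> s\<close> the expression is
  \<open>(1 - \<kappa> s\<^sup>3) + \<kappa> (r - s)\<^sup>2 (2 r + s)\<close>, and \<open>B\<^sup>3 < 27 \<kappa>\<^sup>2\<close> says \<open>\<kappa> s\<^sup>3 < 1\<close>.\<close>

lemma cubic_positive_on_ray:
  fixes B \<kappa> r :: real
  assumes "0 \<le> \<kappa>" "B \<le> 0 \<or> (0 < \<kappa> \<and> B ^ 3 < 27 * \<kappa>\<^sup>2)" "0 < r"
  shows "0 < 1 - B * r\<^sup>2 + 2 * \<kappa> * r ^ 3"
proof (cases "B \<le> 0")
  case True
  then have "0 \<le> - B * r\<^sup>2" by (intro mult_nonneg_nonneg) auto
  moreover have "0 \<le> 2 * \<kappa> * r ^ 3" using assms by (intro mult_nonneg_nonneg) auto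
  ultimately show ?thesis by linarith
next
  case False
  then have \<kappa>: "0 < \<kappa>" "B ^ 3 < 27 * \<kappa>\<^sup>2" using assms by auto
  define s where "s = B / (3 * \<kappa>)"
  have s: "0 < s" "B = 3 * \<kappa> * s" using False \<kappa> by (auto simp: s_def)
  have "\<kappa>\<^sup>2 * (27 * (\<kappa> * s ^ 3)) < \<kappa>\<^sup>2 * 27"
    using \<kappa>(2) unfolding s(2) by (simp add: power_mult_distrib power2_eq_square power3_eq_cube algebra_simps)
  then have "\<kappa> * s ^ 3 < 1" using \<kappa>(1) by (simp add: mult_less_cancel_left)
  moreover have "0 \<le> \<kappa> * ((r - s)\<^sup>2 * (2 * r + s))" using \<kappa> s assms by (intro mult_nonneg_nonneg) auto
  moreover have "1 - B * r\<^sup>2 + 2 * \<kappa> * r ^ 3 = (1 - \<kappa> * s ^ 3) + \<kappa> * ((r - s)\<^sup>2 * (2 * r + s))"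
    unfolding s(2) by (simp add: power2_eq_square power3_eq_cube algebra_simps)
  ultimately show ?thesis by linarith
qed

text \<open>The point is that \<open>P(m) / m\<close> is not real on the sector. Multiplying by the conjugate of \<open>m\<close>,
  its imaginary part has the sign of \<open>- Im m (1 - B \<bar>m\<bar>\<^sup>2 - 2 c Re m \<bar>m\<bar>\<^sup>2)\<close>.
  The sector consists of the \<open>m\<close> in the lower half plane whose argument is so close to that of the real half line
  \<open>\<sigma> m < 0\<close> that \<open>c Re m \<le> - \<mu> \<bar>c\<bar> \<bar>m\<bar>\<close>.\<close>

lemma cubic_sector_transversal:
  fixes m :: complex and a B c \<mu> \<sigma> :: real
  assumes \<sigma>: "c = \<bar>c\<bar> * \<sigma>" and \<mu>: "0 \<le> \<mu>" "B \<le> 0 \<or> (0 < \<mu> * \<bar>c\<bar> \<and> B ^ 3 < 27 * (\<mu> * \<bar>c\<bar>)\<^sup>2)"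
    and m: "Im m < 0" "\<sigma> * Re m + \<mu> * cmod m < 0"
  shows "1 + of_real a * m + of_real B * m\<^sup>2 + of_real c * m ^ 3 - m * of_real x \<noteq> 0"
proof
  define r where "r = cmod m"
  have "m \<noteq> 0" using m by auto
  then have r: "0 < r" by (simp add: r_def)
  have r2: "r\<^sup>2 = (Re m)\<^sup>2 + (Im m)\<^sup>2" unfolding r_def by (rule cmod_power2)
  have "c * Re m = \<bar>c\<bar> * (\<sigma> * Re m)" by (subst \<sigma>) simp
  also have "\<dots> \<le> \<bar>c\<bar> * (- \<mu> * r)" using m(2) by (intro mult_left_mono) (auto simp: r_def)
  finally have "c * Re m * r\<^sup>2 \<le> - (\<mu> * \<bar>c\<bar>) * r * r\<^sup>2" by (intro mult_right_mono) (simp_all add: mult_ac)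
  moreover have "0 < 1 - B * r\<^sup>2 + 2 * (\<mu> * \<bar>c\<bar>) * r ^ 3"
    by (rule cubic_positive_on_ray[OF _ \<mu>(2) r]) (use \<mu>(1) in simp)
  ultimately have "0 < 1 - B * r\<^sup>2 - 2 * (c * Re m * r\<^sup>2)"
    by (simp add: power2_eq_square power3_eq_cube mult_ac)
  then have pos: "0 < - Im m * (1 - B * r\<^sup>2 - 2 * (c * Re m * r\<^sup>2))"
    using m(1) by (intro mult_pos_pos) auto
  assume "1 + of_real a * m + of_real B * m\<^sup>2 + of_real c * m ^ 3 - m * of_real x = 0"
  then have "Im ((1 + of_real a * m + of_real B * m\<^sup>2 + of_real c * m ^ 3 - m * of_real x) * cnj m) = 0" by simp
  moreover have "Im ((1 + of_real a * m + of_real B * m\<^sup>2 + of_real c * m ^ 3 - m * of_real x) * cnj m) =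
      - Im m * (1 - B * r\<^sup>2 - 2 * (c * Re m * r\<^sup>2))"
    unfolding r2 by (simp add: power2_eq_square power3_eq_cube algebra_simps)
  ultimately have "- Im m * (1 - B * r\<^sup>2 - 2 * (c * Re m * r\<^sup>2)) = 0" by metis
  with pos show False by linarith
qed

lemma cubic_norm_growth:
  fixes a B c :: real and d :: complex
  assumes "c \<noteq> 0 \<or> B \<noteq> 0" and d: "d \<noteq> 0"
  obtains k where "0 < k" "eventually (\<lambda>t::real. k * t\<^sup>2 \<le>
    cmod (1 + of_real a * (of_real t * d) + of_real B * (of_real t * d)\<^sup>2 + of_real c * (of_real t * d) ^ 3)) at_top"
proof -
  let ?P = "\<lambda>t::real. 1 + of_real a * (of_real t * d) + of_real B * (of_real t * d)\<^sup>2 + of_real c * (of_real t * d) ^ 3"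
  define D where "D = cmod d"
  have D: "0 < D" using d by (simp add: D_def)
  have tri: "cmod u - cmod v - cmod w - 1 \<le> cmod (1 + w + v + u)" for u v w :: complex
    using norm_triangle_ineq4[of "1 + w + v + u" "1 + w + v"] norm_triangle_ineq[of "1 + w" v] norm_triangle_ineq[of 1 w]
    by simp
  have low: "\<bar>c\<bar> * D ^ 3 * t ^ 3 - \<bar>B\<bar> * D\<^sup>2 * t\<^sup>2 - \<bar>a\<bar> * D * t - 1 \<le> cmod (?P t)" if "0 < t" for t
    using tri[of "of_real c * (of_real t * d) ^ 3" "of_real B * (of_real t * d)\<^sup>2" "of_real a * (of_real t * d)"] that
    by (simp add: norm_mult norm_power D_def power_mult_distrib mult_ac)
  show ?thesis
  proof (cases "c = 0")
    case False
    then have "0 < \<bar>c\<bar> * D ^ 3" using D by simp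
    then have "eventually (\<lambda>t::real. 1 * t\<^sup>2 \<le> (\<bar>c\<bar> * D ^ 3) * t ^ 3 - (\<bar>B\<bar> * D\<^sup>2) * t\<^sup>2 - (\<bar>a\<bar> * D) * t - 1) at_top"
      by real_asymp
    then have "eventually (\<lambda>t. 1 * t\<^sup>2 \<le> cmod (?P t)) at_top"
      using eventually_gt_at_top[of 0] by eventually_elim (use low in \<open>force intro: order_trans\<close>)
    then show ?thesis by (intro that[of 1]) simp_all
  next
    case True
    define k where "k = \<bar>B\<bar> * D\<^sup>2 / 2"
    have k: "0 < k" using True assms(1) D by (simp add: k_def)
    have low': "2 * k * t\<^sup>2 - \<bar>a\<bar> * D * t - 1 \<le> cmod (?P t)" if "0 < t" for t
      using tri[of "of_real B * (of_real t * d)\<^sup>2" "of_real a * (of_real t * d)" 0] that True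
      by (simp add: norm_mult norm_power D_def k_def power_mult_distrib mult_ac)
    have "eventually (\<lambda>t::real. k * t\<^sup>2 \<le> 2 * k * t\<^sup>2 - (\<bar>a\<bar> * D) * t - 1) at_top"
      using k by real_asymp
    then have "eventually (\<lambda>t. k * t\<^sup>2 \<le> cmod (?P t)) at_top"
      using eventually_gt_at_top[of 0] by eventually_elim (use low' in \<open>force intro: order_trans\<close>)
    then show ?thesis using k by (intro that)
  qed
qed

lemma csk_prob_imp_integral:
  assumes "real_distribution M" "csk_prob M V m"
  shows "(LINT x|M. csk_density V x m) = 1"
proof -
  interpret real_distribution M by fact
  let ?f = "\<lambda>x. csk_density V x m"
  have meas [measurable]: "?f \<in> borel_measurable M" unfolding csk_density_def by measurable
  have ae: "AE x in M. 0 \<le> ?f x" using assms(2) by (simp add: csk_prob_def)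
  have "prob_space (density M (\<lambda>x. ennreal (?f x)))" using assms(2) by (simp add: csk_prob_def)
  from prob_space.emeasure_space_1[OF this] have "(\<integral>\<^sup>+x. ennreal (?f x) \<partial>M) = 1"
    by (simp add: emeasure_density cong: nn_integral_cong)
  then show ?thesis using integral_eq_nn_integral[OF meas ae] by simp
qed

text \<open>The identity \<open>h = 1\<close> is continued from the small positive reals through a disc around 0 into the sector \<open>S\<close>. With
  \<open>p = \<bar>P(m)\<bar>\<close>, the bound \<open>E(w) = 1 + O(w\<^sup>2)\<close> gives \<open>p\<^sup>2 \<le> 2 R\<^sup>2 (p + \<bar>m\<bar>\<^sup>2)\<close>, while \<open>p\<close>
  grows at least like \<open>\<bar>m\<bar>\<^sup>2\<close>.\<close>

theorem cubic_condition_if_variance_function: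
  fixes a b c :: real
  assumes "is_variance_function M (\<lambda>m. 1 + a * m + b * m^2 + c * m^3)"
  shows "27 * c\<^sup>2 \<le> (b + 1) ^ 3"
proof (rule ccontr)
  assume "\<not> 27 * c\<^sup>2 \<le> (b + 1) ^ 3"
  define B where "B = b + 1"
  have neg: "B ^ 3 < 27 * c\<^sup>2" using \<open>\<not> _\<close> by (simp add: B_def)
  define V where "V = (\<lambda>m. 1 + a * m + b * m^2 + c * m^3)"
  obtain m1 m2 where gen: "csk_generator M" and m12: "m1 < 0" "0 < m2" "\<And>m. m1 < m \<Longrightarrow> m < m2 \<Longrightarrow> csk_prob M V m"
    using assms unfolding is_variance_function_def V_def[symmetric] by (auto simp: V_def)
  have dist: "real_distribution M" and mean: "(LINT x|M. x) = 0"
    using gen by (auto simp: csk_generator_def real_distribution_def real_distribution_axioms_def)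
  obtain C where C: "compact C" "AE x in M. x \<in> C"
    using gen by (auto simp: csk_generator_def compactly_supported_def)
  obtain R where R: "0 < R" "\<And>x. x \<in> C \<Longrightarrow> norm x \<le> R"
    using compact_imp_bounded[OF C(1)] by (auto simp: bounded_pos)
  have supp: "AE x in M. \<bar>x\<bar> \<le> R"
    using C(2) by (rule eventually_mono) (use R(2) in simp)
  define E where "E = moment_gf M"
  define P where "P m = 1 + of_real a * m + of_real B * m\<^sup>2 + of_real c * m ^ 3" for m :: complex
  define W where "W m = m / P m" for m
  \<comment> \<open>The total mass of the member with parameter \<open>m\<close>, as a function of complex \<open>m\<close>.\<close>
  define h where "h m = (P m - m\<^sup>2) / P m * E (W m)" for m

  define q where "q = max 0 (B ^ 3 / (27 * c\<^sup>2))"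
  \<comment> \<open>Any opening \<open>\<mu> < 1\<close> of the sector with \<open>\<mu>\<^sup>2 > B\<^sup>3 / (27 c\<^sup>2)\<close> works; the maximum
    with 0 keeps the root real for \<open>B < 0\<close>. If \<open>c = 0\<close>, the quotient is 0 and \<open>B < 0\<close>.\<close>
  define \<mu> where "\<mu> = sqrt ((q + 1) / 2)"
  define \<sigma> where "\<sigma> = (if c < 0 then -1 else 1 :: real)"
  have \<sigma>: "c = \<bar>c\<bar> * \<sigma>" "\<sigma> * \<sigma> = 1" "\<bar>\<sigma>\<bar> = 1" by (auto simp: \<sigma>_def)
  have q: "0 \<le> q" "q < 1" using neg by (auto simp: q_def divide_simps)
  have \<mu>: "0 < \<mu>" "\<mu> < 1" "\<mu>\<^sup>2 = (q + 1) / 2" using q by (auto simp: \<mu>_def)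
  have alt: "B \<le> 0 \<or> (0 < \<mu> * \<bar>c\<bar> \<and> B ^ 3 < 27 * (\<mu> * \<bar>c\<bar>)\<^sup>2)"
  proof (cases "B \<le> 0")
    case False
    then have "0 < B ^ 3" by simp
    then have c: "c \<noteq> 0" using neg by auto
    have "B ^ 3 / (27 * c\<^sup>2) \<le> q" by (simp add: q_def)
    also have "q < \<mu>\<^sup>2" using q \<mu>(3) by simp
    finally have "B ^ 3 < \<mu>\<^sup>2 * (27 * c\<^sup>2)" using c by (simp add: divide_less_eq)
    then show ?thesis using c \<mu>(1) by (simp add: power_mult_distrib mult_ac)
  qed simp

  define S where "S = {m. Im m < 0 \<and> \<sigma> * Re m + \<mu> * cmod m < 0}"
  have PS: "P m - m * of_real x \<noteq> 0" if "m \<in> S" for m x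
    using cubic_sector_transversal[OF \<sigma>(1) less_imp_le[OF \<mu>(1)] alt, of m a x] that by (simp add: S_def P_def)
  have "open S" unfolding S_def by (intro open_Collect_conj open_Collect_less continuous_intros)
  have "convex S"
  proof (rule convexI)
    fix x y :: complex and u v :: real
    assume xy: "x \<in> S" "y \<in> S" and uv: "0 \<le> u" "0 \<le> v" "u + v = 1"
    have lin: "u * f + v * g < 0" if "f < 0" "g < 0" for f g :: real
      using that uv by (smt (verit) mult_nonneg_nonpos mult_pos_neg)
    have "cmod (u *\<^sub>R x + v *\<^sub>R y) \<le> u * cmod x + v * cmod y"
      using norm_triangle_ineq[of "u *\<^sub>R x" "v *\<^sub>R y"] uv by simp
    then have "\<mu> * cmod (u *\<^sub>R x + v *\<^sub>R y) \<le> \<mu> * (u * cmod x + v * cmod y)"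
      using \<mu>(1) by (intro mult_left_mono) auto
    then have "\<sigma> * Re (u *\<^sub>R x + v *\<^sub>R y) + \<mu> * cmod (u *\<^sub>R x + v *\<^sub>R y)
        \<le> u * (\<sigma> * Re x + \<mu> * cmod x) + v * (\<sigma> * Re y + \<mu> * cmod y)"
      by (simp add: algebra_simps)
    also have "\<dots> < 0" using xy by (intro lin) (auto simp: S_def)
    finally show "u *\<^sub>R x + v *\<^sub>R y \<in> S" using lin[of "Im x" "Im y"] xy by (simp add: S_def)
  qed
  \<comment> \<open>A direction inside the sector: its modulus is at most \<open>1 + (1 / \<mu> - 1) / 2 < 1 / \<mu>\<close>.\<close>
  define d where "d = Complex (- \<sigma>) (- ((1 / \<mu> - 1) / 2))"
  have dS: "of_real t * d \<in> S" if "0 < t" for t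
  proof -
    have \<eta>: "0 < (1 / \<mu> - 1) / 2" using \<mu> by simp
    have "cmod d \<le> \<bar>Re d\<bar> + \<bar>Im d\<bar>" by (rule cmod_le)
    also have "\<dots> = 1 + (1 / \<mu> - 1) / 2" using \<eta> \<sigma>(3) by (simp add: d_def)
    also have "\<dots> < 1 / \<mu>"
    proof -
      have "1 + (y - 1) / 2 < y" if "1 < y" for y :: real using that by (simp add: field_simps)
      then show ?thesis using \<mu> by simp
    qed
    finally have "\<mu> * cmod d < 1" using \<mu>(1) by (simp add: field_simps)
    then have "t * (\<mu> * cmod d) < t * 1" using that by (rule mult_strict_left_mono)
    moreover have "\<sigma> * Re (of_real t * d) = - t" using \<sigma>(2) by (simp add: d_def)
    moreover have "Im (of_real t * d) < 0" using \<eta> that by (simp add: d_def mult_less_0_iff mult_pos_pos)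
    ultimately show ?thesis using that by (simp add: S_def norm_mult mult_ac)
  qed
  have d0: "d \<noteq> 0" using dS[of 1] by (auto simp: S_def)

  have contP: "isCont P 0" and contW: "isCont W 0"
    unfolding P_def[abs_def] W_def[abs_def] by (auto intro!: continuous_intros)
  have "P 0 = 1" "W 0 = 0" by (simp_all add: P_def W_def)
  then have "eventually (\<lambda>m. cmod (P m - 1) < 1) (nhds 0)" "eventually (\<lambda>m. cmod (W m) < 1 / R) (nhds 0)"
    using tendstoD[OF tendsto_nhds_if_isCont[OF contP], of 1] tendstoD[OF tendsto_nhds_if_isCont[OF contW], of "1 / R"] R(1)
    by (simp_all add: dist_norm)
  then have "eventually (\<lambda>m. cmod (P m - 1) < 1 \<and> cmod (W m) < 1 / R) (nhds 0)" by (rule eventually_conj)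
  then obtain \<epsilon> where \<epsilon>: "0 < \<epsilon>" "\<And>m. cmod m < \<epsilon> \<Longrightarrow> cmod (P m - 1) < 1 \<and> cmod (W m) < 1 / R"
    unfolding eventually_nhds_metric by (auto simp: dist_norm)

  define D where "D = ball 0 \<epsilon> \<union> S"
  have "open D" unfolding D_def using \<open>open S\<close> by auto
  have "connected D"
    unfolding D_def
  proof (rule connected_Un)
    show "connected S" using \<open>convex S\<close> by (rule convex_connected)
    have "of_real (\<epsilon> / (2 * cmod d)) * d \<in> ball 0 \<epsilon> \<inter> S"
      using dS[of "\<epsilon> / (2 * cmod d)"] \<epsilon>(1) d0 by (simp add: norm_mult norm_divide)
    then show "ball 0 \<epsilon> \<inter> S \<noteq> {}" by blast
  qed (rule connected_ball)
  have PD: "P m \<noteq> 0 \<and> (\<forall>x. \<bar>x\<bar> \<le> R \<longrightarrow> 1 - W m * complex_of_real x \<noteq> 0)" if "m \<in> D" for m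
  proof (cases "m \<in> S")
    case True
    have P: "P m \<noteq> 0" using PS[OF True, of 0] by simp
    have "1 - W m * of_real x = (P m - m * of_real x) / P m" for x
      using P by (simp add: W_def field_simps)
    with P PS[OF True] show ?thesis by simp
  next
    case False
    then have m: "cmod m < \<epsilon>" using that by (auto simp: D_def)
    have "P m \<noteq> 0" using \<epsilon>(2)[OF m] by auto
    moreover have "1 - W m * complex_of_real x \<noteq> 0" if x: "\<bar>x\<bar> \<le> R" for x
    proof
      assume "1 - W m * complex_of_real x = 0"
      then have "1 = cmod (W m * complex_of_real x)" by simp
      also have "\<dots> \<le> cmod (W m) * R" unfolding norm_mult using x by (intro mult_left_mono) auto
      also have "\<dots> < 1" using \<epsilon>(2)[OF m] R(1) by (simp add: field_simps)
      finally show False by simp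
    qed
    ultimately show ?thesis by blast
  qed
  have P_hol: "P holomorphic_on D" unfolding P_def[abs_def] by (intro holomorphic_intros)
  have W_hol: "W holomorphic_on D"
    unfolding W_def[abs_def] by (rule holomorphic_on_divide[OF holomorphic_on_ident P_hol]) (use PD in blast)
  define \<Omega> where "\<Omega> = {w. \<forall>x. \<bar>x\<bar> \<le> R \<longrightarrow> 1 - w * complex_of_real x \<noteq> 0}"
  have E_hol: "E holomorphic_on \<Omega>"
    unfolding holomorphic_on_def
  proof
    fix w assume w: "w \<in> \<Omega>"
    have "E field_differentiable at w"
      unfolding E_def
    proof (rule moment_gf_field_differentiable[OF dist supp R(1)])
      show "1 - w * complex_of_real x \<noteq> 0" if "\<bar>x\<bar> \<le> R" for x
        using w that unfolding \<Omega>_def by blast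
    qed
    then show "E field_differentiable at w within \<Omega>" by (rule field_differentiable_at_within)
  qed
  have "W ` D \<subseteq> \<Omega>" using PD unfolding \<Omega>_def by blast
  with W_hol E_hol have "(E \<circ> W) holomorphic_on D" by (rule holomorphic_on_compose_gen)
  then have EW_hol: "(\<lambda>m. E (W m)) holomorphic_on D" by (simp only: o_def)
  have "(\<lambda>m. (P m - m\<^sup>2) / P m) holomorphic_on D"
    by (intro holomorphic_on_divide P_hol holomorphic_intros) (use PD in blast)
  then have hol: "(\<lambda>m. h m - 1) holomorphic_on D"
    unfolding h_def by (intro holomorphic_on_diff holomorphic_on_mult EW_hol holomorphic_on_const)

  have real_case: "h (of_real t) = 1" if t: "0 < t" "t < \<epsilon>" "t < m2" for t :: real
  proof -
    define p where "p = 1 + a * t + B * t\<^sup>2 + c * t ^ 3"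
    have Pt: "P (of_real t) = of_real p" by (simp add: P_def p_def)
    have p0: "p \<noteq> 0" using PD[of "of_real t"] t Pt by (auto simp: D_def)
    have V: "V t = p - t\<^sup>2" by (simp add: V_def p_def B_def algebra_simps)
    have "csk_density V x t = (p - t\<^sup>2) / p * (1 / (1 - t / p * x))" for x
    proof -
      have "V t + t * (t - x) = p * (1 - t / p * x)"
        using p0 by (simp add: V field_simps power2_eq_square)
      then show ?thesis using t by (simp add: csk_density_def V)
    qed
    then have "(LINT x|M. (p - t\<^sup>2) / p * (1 / (1 - t / p * x))) = 1"
      using csk_prob_imp_integral[OF dist m12(3)[of t]] t m12(1) by simp
    then have one: "(p - t\<^sup>2) / p * (LINT x|M. 1 / (1 - t / p * x)) = 1"
      by (simp only: integral_mult_right_zero)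
    have "E (W (of_real t)) = (LINT x|M. complex_of_real (1 / (1 - t / p * x)))"
      by (simp add: E_def moment_gf_def W_def Pt)
    also have "\<dots> = of_real (LINT x|M. 1 / (1 - t / p * x))" by (rule integral_complex_of_real)
    finally have "h (of_real t) = of_real ((p - t\<^sup>2) / p * (LINT x|M. 1 / (1 - t / p * x)))"
      by (simp add: h_def Pt)
    then show ?thesis by (simp only: one of_real_1)
  qed
  define U where "U = complex_of_real ` {0<..<min \<epsilon> m2}"
  have lim: "0 islimpt U"
    unfolding islimpt_approachable
  proof (intro allI impI)
    fix e :: real assume e: "0 < e"
    define t where "t = min e (min \<epsilon> m2) / 2"
    have t: "0 < t" "t < e" "t < \<epsilon>" "t < m2" using e \<epsilon>(1) m12(2) by (auto simp: t_def)
    then show "\<exists>x'\<in>U. x' \<noteq> 0 \<and> dist x' 0 < e"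
      by (intro bexI[of _ "complex_of_real t"]) (auto simp: U_def)
  qed
  have h1: "h m = 1" if "m \<in> D" for m
  proof -
    have "h m - 1 = 0"
    proof (rule analytic_continuation[OF hol \<open>open D\<close> \<open>connected D\<close> _ _ lim _ that])
      show "U \<subseteq> D" "0 \<in> D" using \<epsilon>(1) by (auto simp: U_def D_def)
      show "h z - 1 = 0" if "z \<in> U" for z using that real_case by (auto simp: U_def)
    qed
    then show ?thesis by simp
  qed

  have "c \<noteq> 0 \<or> B \<noteq> 0" using neg by auto
  then obtain k where k: "0 < k" "eventually (\<lambda>t::real. k * t\<^sup>2 \<le> cmod (P (of_real t * d))) at_top"
    using cubic_norm_growth[of c B d a] d0 unfolding P_def by blast
  define N where "N = cmod d"
  have "eventually (\<lambda>t::real. 2 * R * N * t \<le> k * t\<^sup>2) at_top"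
    using k(1) by real_asymp
  moreover have "eventually (\<lambda>t::real. 2 * R\<^sup>2 * N\<^sup>2 / k + 2 * R\<^sup>2 < k * t\<^sup>2) at_top"
    using k(1) by real_asymp
  ultimately have "eventually (\<lambda>t::real. 0 < t \<and> 2 * R * N * t \<le> k * t\<^sup>2 \<and> 2 * R\<^sup>2 * N\<^sup>2 / k + 2 * R\<^sup>2 < k * t\<^sup>2
      \<and> k * t\<^sup>2 \<le> cmod (P (of_real t * d))) at_top"
    using k(2) eventually_gt_at_top[of 0] by eventually_elim simp
  then obtain t where t: "0 < t" "2 * R * N * t \<le> k * t\<^sup>2" "2 * R\<^sup>2 * N\<^sup>2 / k + 2 * R\<^sup>2 < k * t\<^sup>2"
      "k * t\<^sup>2 \<le> cmod (P (of_real t * d))"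
    by (auto dest: eventually_happens)
  define m where "m = of_real t * d"
  define p where "p = cmod (P m)"
  have m: "m \<in> D" using dS[OF t(1)] by (simp add: m_def D_def)
  have m_norm: "cmod m = t * N" using t(1) by (simp add: m_def N_def norm_mult)
  have kt: "0 < k * t\<^sup>2" using t(1) k(1) by simp
  have p: "k * t\<^sup>2 \<le> p" using t(4) by (simp only: p_def m_def)
  have p_pos: "0 < p" using kt p by linarith
  have W: "cmod (W m) = t * N / p" by (simp add: W_def norm_divide m_norm p_def)
  have "cmod (W m) * R \<le> 1 / 2" using t(2) p p_pos by (simp add: W field_simps)
  from moment_gf_centered_bound[OF dist supp R(1) mean this]
  have E1: "cmod (E (W m) - 1) \<le> 2 * R\<^sup>2 * (t * N / p)\<^sup>2" by (simp add: E_def W)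
  have P0: "P m \<noteq> 0" using p_pos by (auto simp: p_def)
  have h: "(P m - m\<^sup>2) / P m * E (W m) = 1" using h1[OF m] by (simp add: h_def)
  then have V0: "P m - m\<^sup>2 \<noteq> 0" by auto
  have "E (W m) = P m / (P m - m\<^sup>2)" using h P0 V0 by (simp add: field_simps)
  then have "E (W m) - 1 = m\<^sup>2 / (P m - m\<^sup>2)" using V0 by (simp add: field_simps)
  then have "cmod (E (W m) - 1) = (t * N)\<^sup>2 / cmod (P m - m\<^sup>2)" by (simp add: norm_divide norm_power m_norm)
  with E1 have "(t * N)\<^sup>2 / cmod (P m - m\<^sup>2) \<le> 2 * R\<^sup>2 * (t * N)\<^sup>2 / p\<^sup>2" by (simp add: power_divide)
  moreover have "0 < (t * N)\<^sup>2" "0 < cmod (P m - m\<^sup>2)" using t(1) d0 V0 by (simp_all add: N_def)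
  moreover have "y \<le> r * z" if "x / z \<le> r * x / y" "0 < x" "0 < z" "0 < y" for x y z r :: real
  proof -
    have "x * y \<le> x * (r * z)" using that by (simp add: field_simps)
    then show ?thesis using that(2) by simp
  qed
  ultimately have "p\<^sup>2 \<le> 2 * R\<^sup>2 * cmod (P m - m\<^sup>2)" using p_pos by simp
  also have "\<dots> \<le> 2 * R\<^sup>2 * (p + (t * N)\<^sup>2)"
    using norm_triangle_ineq4[of "P m" "m\<^sup>2"] by (intro mult_left_mono) (simp_all add: p_def norm_power m_norm)
  finally have upper: "p * (p - 2 * R\<^sup>2) \<le> 2 * R\<^sup>2 * N\<^sup>2 * t\<^sup>2"
    by (simp add: power2_eq_square algebra_simps)
  have "k * t\<^sup>2 * (2 * R\<^sup>2 * N\<^sup>2 / k) < p * (p - 2 * R\<^sup>2)"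
    using p t(3) kt k(1) by (intro mult_le_less_imp_less) auto
  moreover have "k * t\<^sup>2 * (2 * R\<^sup>2 * N\<^sup>2 / k) = 2 * R\<^sup>2 * N\<^sup>2 * t\<^sup>2" using k(1) by simp
  ultimately show False using upper by simp
qed

section \<open>The cubic variance functions\<close>

lemma cubic_in_variance_class_iff:
  "(\<lambda>m. 1 + a * m + b * m^2 + c * m^3) \<in> variance_class \<longleftrightarrow> 27 * c\<^sup>2 \<le> (b + 1) ^ 3"
  using cubic_in_variance_class[of c b a] cubic_condition_if_variance_function[of _ a b c]
  by (auto simp: variance_class_def)

text \<open>Dividing by \<open>k\<^sup>6\<close> and letting \<open>k\<close> tend to infinity removes the summand 1; conversely \<open>b \<ge> 0\<close>, so the
  summand 1 only helps.\<close>

lemma scaled_cubic_condition_iff: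
  fixes b c :: real
  shows "(\<forall>k. 27 * (c * k ^ 3)\<^sup>2 \<le> (b * k\<^sup>2 + 1) ^ 3) \<longleftrightarrow> 27 * c\<^sup>2 \<le> b ^ 3"
proof
  assume *: "\<forall>k. 27 * (c * k ^ 3)\<^sup>2 \<le> (b * k\<^sup>2 + 1) ^ 3"
  have "27 * c\<^sup>2 \<le> (b + 1 / (real (Suc n))\<^sup>2) ^ 3" for n
  proof -
    let ?k = "real (Suc n)"
    have "27 * c\<^sup>2 * ?k ^ 6 \<le> (b * ?k\<^sup>2 + 1) ^ 3"
      using *[rule_format, of ?k] by (simp add: power_mult_distrib flip: power_mult)
    also have "b * ?k\<^sup>2 + 1 = (b + 1 / ?k\<^sup>2) * ?k\<^sup>2" by (simp add: distrib_right del: of_nat_Suc)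
    also have "\<dots> ^ 3 = (b + 1 / ?k\<^sup>2) ^ 3 * ?k ^ 6" by (simp add: power_mult_distrib flip: power_mult)
    finally show ?thesis by (rule mult_right_le_imp_le) simp
  qed
  moreover have "(\<lambda>n. (b + 1 / (real (Suc n))\<^sup>2) ^ 3) \<longlonglongrightarrow> b ^ 3"
    using tendsto_power[OF tendsto_add[OF tendsto_const[of b] tendsto_power[OF LIMSEQ_inverse_real_of_nat, of 2]], of 3]
    by (simp add: inverse_eq_divide power_one_over del: of_nat_Suc)
  ultimately show "27 * c\<^sup>2 \<le> b ^ 3" by (intro LIMSEQ_le_const) auto
next
  assume *: "27 * c\<^sup>2 \<le> b ^ 3"
  then have "0 \<le> b ^ 3" by (rule order_trans[rotated]) simp
  then have b: "0 \<le> b" by (simp add: zero_le_power_eq)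
  show "\<forall>k. 27 * (c * k ^ 3)\<^sup>2 \<le> (b * k\<^sup>2 + 1) ^ 3"
  proof
    fix k :: real
    have "27 * (c * k ^ 3)\<^sup>2 = 27 * c\<^sup>2 * k ^ 6" by (simp add: power_mult_distrib flip: power_mult)
    also have "\<dots> \<le> b ^ 3 * k ^ 6" using * by (rule mult_right_mono) simp
    also have "\<dots> = (b * k\<^sup>2) ^ 3" by (simp add: power_mult_distrib flip: power_mult)
    also have "\<dots> \<le> (b * k\<^sup>2 + 1) ^ 3" using b by (intro power_mono) simp_all
    finally show "27 * (c * k ^ 3)\<^sup>2 \<le> (b * k\<^sup>2 + 1) ^ 3" .
  qed
qed

theorem theorem1p2:
  fixes a b c :: real
  shows "((\<lambda>m. 1 + a * m + b * m^2 + c * m^3) \<in> variance_class \<longleftrightarrow> (b + 1)^3 \<ge> 27 * c^2) \<and>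
         ((\<lambda>m. 1 + a * m + b * m^2 + c * m^3) \<in> variance_class_inf \<longleftrightarrow> b^3 \<ge> 27 * c^2)"
proof
  let ?V = "\<lambda>m. 1 + a * m + b * m^2 + c * m^3"
  show "?V \<in> variance_class \<longleftrightarrow> (b + 1)^3 \<ge> 27 * c^2" by (rule cubic_in_variance_class_iff)
  have scaled: "(\<lambda>m. ?V (k * m)) \<in> variance_class \<longleftrightarrow> 27 * (c * k ^ 3)\<^sup>2 \<le> (b * k\<^sup>2 + 1) ^ 3" for k
  proof -
    have "(\<lambda>m. ?V (k * m)) = (\<lambda>m. 1 + (a * k) * m + (b * k\<^sup>2) * m^2 + (c * k ^ 3) * m^3)"
      by (simp add: power_mult_distrib mult.assoc)
    then show ?thesis by (simp only: cubic_in_variance_class_iff)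
  qed
  have "?V \<in> variance_class_inf \<longleftrightarrow> ?V \<in> variance_class \<and> (\<forall>k. (\<lambda>m. ?V (k * m)) \<in> variance_class)"
    by (simp add: variance_class_inf_def)
  also have "\<dots> \<longleftrightarrow> (\<forall>k. (\<lambda>m. ?V (k * m)) \<in> variance_class)"
    by (auto dest: spec[of _ 1])
  also have "\<dots> \<longleftrightarrow> b^3 \<ge> 27 * c^2"
    unfolding scaled by (rule scaled_cubic_condition_iff)
  finally show "?V \<in> variance_class_inf \<longleftrightarrow> b^3 \<ge> 27 * c^2" .
qed

end
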